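(* Consider a Markov game with self-play witness rank $d$ (with constants $\kappa_{\mathrm{wit}}>0$ and $B$). Choose $\ell(f,\xi_h)=D_{\mathrm{He}}^2(\mathbb P_{f,h}(\cdot|\xi_h),\mathbb P_{f^*,h}(\cdot|\xi_h))$ with $\xi_h=(s_h,a_h,b_h)$. Then, when $T$ is sufficiently large, $$\text{MG with low self-play witness rank}\ \subset\ \text{MG with low self-play GEC},$$ with the self-play GEC $d_{\mathrm{GEC}}$ satisfying $$d_{\mathrm{GEC}}=\frac{4H^3d}{\kappa_{\mathrm{wit}}^2}\log\Big(1+\frac{THB^2}{4d\epsilon\kappa_{\mathrm{wit}}^2}\Big),$$ where $\epsilon>0$ is the parameter in the definition of self-play GEC.
   Context: **FOMG.** An episodic two-player zero-sum fully observable Markov game has state space $\mathcal S$, action spaces $\mathcal A,\mathcal B$, episode length $H$, transition kernels $\mathbb P_h(s'|s,a,b)$, rewards $r_h(s,a,b)\in[0,1]$, and a fixed initial state $s_1$. Policies are Markovian. A model $f$ in the model class $\mathcal F$ specifies transition kernels $\mathbb P_{f,h}$; $V_f^{\pi,\nu}$ is the expected value of $\sum_{h=1}^Hr_h(s_h,a_h,b_h)$ under $\pi,\nu,\mathbb P_f$, and $V_{f,h}^{\pi,\nu}(s)$, $Q_{f,h}^{\pi,\nu}(s,a,b)$ are the step-$h$ state and state-action value functions ($V_{f,H+1}^{\pi,\nu}=0$). The true model is $f^*\in\mathcal F$. The number of episodes is $T$. **Witnessed model misfit.** Suppose there is a discriminator class $\mathcal U$ of functions $u:\mathcal S\times\mathcal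 A\times\mathcal B\times\mathcal S\to[0,H]$. For $f,g,\rho\in\mathcal F$ let $\breve\pi=\arg\max_\pi\min_\nu V_f^{\pi,\nu}$, $\breve\nu=\arg\min_\nu V_g^{\breve\pi,\nu}$ and $$\mathcal W(f,g,\rho,h)=\sup_{u\in\mathcal U}\Big|\mathbb E_{(s_h,a_h,b_h)\sim\mathbb P_{f^*},\breve\pi,\breve\nu}\big[\mathbb E_{s'\sim\mathbb P_{\rho,h}(\cdot|s_h,a_h,b_h)}u(s_h,a_h,b_h,s')-\mathbb E_{s_{h+1}\sim\mathbb P_{f^*,h}(\cdot|s_h,a_h,b_h)}u(s_h,a_h,b_h,s_{h+1})\big]\Big|.$$ **Bellman residual.** $\mathcal E_{f,h}^{\pi,\nu}=\mathbb E_{\pi,\nu,\mathbb P_{f^*}}\big[Q_{f,h}^{\pi,\nu}(s_h,a_h,b_h)-\mathbb E_{s_{h+1}\sim\mathbb P_{f^*,h}(\cdot|s_h,a_h,b_h)}(r_h(s_h,a_h,b_h)+V_{f,h+1}^{\pi,\nu}(s_{h+1}))\big]$. **Self-play witness rank.** There exist functions $\mathbf W_h:\mathcal F\times\mathcal F\to\mathbb R^d$, $\mathbf X_h:\mathcal F\to\mathbb R^d$ and a constant $\kappa_{\mathrm{wit}}>0$ such that $$\kappa_{\mathrm{wit}}|\mathcal E_{\rho,h}^{\breve\pi,\breve\nu}|\le\langle\mathbf W_h(f,g),\mathbf X_h(\rho)\rangle,\qquad\mathcal W(f,g,\rho,h)\ge\langle\mathbf W_h(f,g),\mathbf X_h(\rho)\rangle,$$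 where $\breve\pi=\arg\max_\pi\min_\nu V_f^{\pi,\nu}$ and $\breve\nu=\arg\min_\nu V_g^{\breve\pi,\nu}$ with $f,g\in\mathcal F$, and $\|\mathbf W_h(\cdot)\|_2\le HB$ for a constant $B$ and $\|\mathbf X_h(\cdot)\|_2\le1$ for any step $h$. The witness rank is the dimension $d$ of the range spaces of $\mathbf W$ and $\mathbf X$. **Hellinger distance.** $D_{\mathrm{He}}^2(P,Q)=\frac12\,\mathbb E_{x\sim P}\big(\sqrt{\mathrm dQ(x)/\mathrm dP(x)}-1\big)^2$. **Self-play GEC.** Let $\sigma^t=(\pi^t,\nu^t)$ be the joint exploration policy, and let $\mathbb E_{(\sigma,h)}$ denote expectation over the data point $\xi_h$ collected by executing $\sigma$ in the true model up to step $h$. For any sequences $f^t,g^t\in\mathcal F$, suppose $(\pi^t,\nu^t)$ satisfies (a) $\pi^t=\arg\max_\pi\min_\nu V_{f^t}^{\pi,\nu}$ and $\nu^t=\arg\min_\nu V_{g^t}^{\pi^t,\nu}$, or (b) $\nu^t=\arg\min_\nu\max_\pi V_{f^t}^{\pi,\nu}$ and $\pi^t=\arg\max_\pi V_{g^t}^{\pi,\nu^t}$. The self-play GEC $d_{\mathrm{GEC}}$ is the minimal constant $D$ such that, for any $\rho\in\{f,g\}$ and any such $(\pi^t,\nu^t)$, $$\Big|\sum_{t=1}^T\big(V^{\pi^t,\nu^t}_{\rho^t}-V^{\pi^t,\nu^t}_{f^*}\big)\Big|\le\Big[D\sum_{h=1}^H\sum_{t=1}^T\sum_{\tau=1}^{t-1}\mathbb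 E_{(\sigma^\tau,h)}\ell(\rho^t,\xi_h^\tau)\Big]^{1/2}+2H(DHT)^{1/2}+\epsilon HT .$$ A class of games with a low $d_{\mathrm{GEC}}$ is called a low self-play GEC class.
   Formalization: The witness-rank inequalities are assumed for whichever of the policy forms (a), (b) the GEC covers, since (a) alone does not give (b); and the minimal constant d_GEC is shown to be at most the formula, since equality fails in general. *)

theory Defs
  imports "HOL-Probability.Probability"
begin

section \<open>Squared Hellinger distance\<close>

definition sum_of_measures :: "'a measure \<Rightarrow> 'a measure \<Rightarrow> 'a measure" where
  "sum_of_measures P Q =
     measure_of (space P) (sets P) (\<lambda>A. emeasure P A + emeasure Q A)"

text \<open>
  The formula \<open>1/2 * E_P (sqrt (dQ/dP) - 1)^2\<close> presupposes that \<open>Q\<close> has a density with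
  respect to \<open>P\<close>.  The definition below is the usual extension to arbitrary pairs of
  probability measures, with densities taken with respect to \<open>P + Q\<close>;
  \<open>hellinger2_eq_RN_deriv\<close> shows that it agrees with the formula whenever \<open>dQ/dP\<close> exists.
\<close>

definition hellinger2 :: "'a measure \<Rightarrow> 'a measure \<Rightarrow> real" where
  "hellinger2 P Q = 1 / 2 *
     (LINT x|sum_of_measures P Q.
        (sqrt (enn2real (RN_deriv (sum_of_measures P Q) Q x))
         - sqrt (enn2real (RN_deriv (sum_of_measures P Q) P x)))\<^sup>2)"

lemma sets_sum_of_measures [simp]: "sets (sum_of_measures P Q) = sets P"
  and space_sum_of_measures [simp]: "space (sum_of_measures P Q) = space P"
  by (simp_all add: sum_of_measures_def)

lemma emeasure_sum_of_measures:
  assumes "sets Q = sets P" and A: "A \<in> sets P"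
  shows "emeasure (sum_of_measures P Q) A = emeasure P A + emeasure Q A"
  unfolding sum_of_measures_def
proof (rule emeasure_measure_of_sigma)
  show "sigma_algebra (space P) (sets P)" ..
  show "positive (sets P) (\<lambda>A. emeasure P A + emeasure Q A)"
    by (simp add: positive_def)
  show "countably_additive (sets P) (\<lambda>A. emeasure P A + emeasure Q A)"
  proof (rule countably_additiveI)
    fix F :: "nat \<Rightarrow> 'a set"
    assume F: "range F \<subseteq> sets P" "disjoint_family F"
    then have FQ: "range F \<subseteq> sets Q" using assms(1) by simp
    show "(\<Sum>i. emeasure P (F i) + emeasure Q (F i)) =
          emeasure P (\<Union>i. F i) + emeasure Q (\<Union>i. F i)"
      by (simp add: suminf_add[symmetric] suminf_emeasure[OF F] suminf_emeasure[OF FQ F(2)])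
  qed
qed (rule A)

lemma hellinger2_eq_RN_deriv:
  assumes P: "prob_space P" and Q: "prob_space Q" and sets_eq: "sets Q = sets P"
    and ac: "absolutely_continuous P Q"
  shows "hellinger2 P Q =
    1 / 2 * (LINT x|P. (sqrt (enn2real (RN_deriv P Q x)) - 1)\<^sup>2)"
proof -
  interpret P: prob_space P by (rule P)
  interpret Q: prob_space Q by (rule Q)
  define M where "M = sum_of_measures P Q"
  have sM [simp, measurable_cong]: "sets M = sets P" by (simp add: M_def)
  have spM: "space M = space P" by (simp add: M_def)
  have em: "emeasure M A = emeasure P A + emeasure Q A" if "A \<in> sets P" for A
    unfolding M_def by (rule emeasure_sum_of_measures[OF sets_eq that])
  have spQ: "space Q = space P" by (rule sets_eq_imp_space_eq[OF sets_eq])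
  interpret M: finite_measure M
    by (rule finite_measureI)
      (use P.emeasure_space_1 Q.emeasure_space_1 in \<open>simp add: spM em spQ\<close>)
  have acP: "absolutely_continuous M P" and acQ: "absolutely_continuous M Q"
    using em sets_eq by (auto simp: absolutely_continuous_def null_sets_def)
  define p where "p = RN_deriv M P"
  define r where "r = RN_deriv P Q"
  have p [measurable]: "p \<in> borel_measurable P"
    using borel_measurable_RN_deriv[of M P] unfolding p_def
    by (simp cong: measurable_cong_sets)
  have r [measurable]: "r \<in> borel_measurable P" unfolding r_def by simp
  have pM [measurable]: "p \<in> borel_measurable M" and rM [measurable]: "r \<in> borel_measurable M"
    using p r by (simp_all cong: measurable_cong_sets)
  have dP: "density M p = P" unfolding p_def
    by (rule M.density_RN_deriv[OF acP]) simp
  have dQ: "density P r = Q" unfolding r_def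
    by (rule P.density_RN_deriv[OF ac sets_eq])
  have "density M (\<lambda>x. p x * r x) = density (density M p) r"
    by (rule density_density_eq[symmetric, OF pM rM])
  then have "density M (\<lambda>x. p x * r x) = Q" by (simp add: dP dQ)
  then have q: "AE x in M. p x * r x = RN_deriv M Q x"
    by (intro M.RN_deriv_unique) measurable
  have fin: "AE x in M. p x \<noteq> \<infinity>"
    unfolding p_def by (rule M.RN_deriv_finite[OF _ acP]) (simp_all add: P.sigma_finite_measure_axioms)
  have dP': "density M (\<lambda>x. ennreal (enn2real (p x))) = P"
  proof -
    have "density M (\<lambda>x. ennreal (enn2real (p x))) = density M p"
      by (rule density_cong) (use pM fin in \<open>auto simp: less_top\<close>)
    then show ?thesis by (simp add: dP)
  qed
  have "(LINT x|P. (sqrt (enn2real (r x)) - 1)\<^sup>2) =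
        (LINT x|density M (\<lambda>x. ennreal (enn2real (p x))). (sqrt (enn2real (r x)) - 1)\<^sup>2)"
    by (simp add: dP')
  also have "\<dots> = (LINT x|M. enn2real (p x) *\<^sub>R (sqrt (enn2real (r x)) - 1)\<^sup>2)"
    by (rule integral_density) simp_all
  also have "\<dots> = (LINT x|M. (sqrt (enn2real (RN_deriv M Q x)) - sqrt (enn2real (p x)))\<^sup>2)"
  proof (rule integral_cong_AE)
    show "AE x in M. enn2real (p x) *\<^sub>R (sqrt (enn2real (r x)) - 1)\<^sup>2 =
        (sqrt (enn2real (RN_deriv M Q x)) - sqrt (enn2real (p x)))\<^sup>2"
      using q
    proof (eventually_elim)
      case (elim x)
      have "(sqrt (enn2real (RN_deriv M Q x)) - sqrt (enn2real (p x)))\<^sup>2 =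
         (sqrt (enn2real (p x)) * (sqrt (enn2real (r x)) - 1))\<^sup>2"
        by (simp add: elim[symmetric] enn2real_mult real_sqrt_mult algebra_simps)
      then show ?case by (simp add: power_mult_distrib)
    qed
  next
    have [measurable]: "RN_deriv M Q \<in> borel_measurable M" by simp
    show "(\<lambda>x. (sqrt (enn2real (RN_deriv M Q x)) - sqrt (enn2real (p x)))\<^sup>2) \<in> borel_measurable M"
      by measurable
  qed measurable
  finally show ?thesis
    unfolding hellinger2_def M_def[symmetric] p_def r_def by simp
qed

section \<open>Episodic two-player zero-sum Markov games with a model class\<close>

text \<open>Steps are numbered \<open>1, ..., horizon G\<close>; values at other indices are irrelevant.\<close>

record ('s, 'a, 'b, 'f) game =
  states :: "'s measure"
  acts_max :: "'a measure"
  acts_min :: "'b measure"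
  horizon :: nat
  reward :: "nat \<Rightarrow> 's \<times> 'a \<times> 'b \<Rightarrow> real"
  init :: 's
  models :: "'f set"
  trans :: "'f \<Rightarrow> nat \<Rightarrow> 's \<times> 'a \<times> 'b \<Rightarrow> 's measure"
  truth :: 'f

type_synonym ('s, 'a) policy = "nat \<Rightarrow> 's \<Rightarrow> 'a measure"

definition data_space :: "('s, 'a, 'b, 'f) game \<Rightarrow> ('s \<times> 'a \<times> 'b) measure" where
  "data_space G = states G \<Otimes>\<^sub>M (acts_max G \<Otimes>\<^sub>M acts_min G)"

definition markov_game :: "('s, 'a, 'b, 'f) game \<Rightarrow> bool" where
  "markov_game G \<longleftrightarrow>
     1 \<le> horizon G \<and>
     init G \<in> space (states G) \<and>
     truth G \<in> models G \<and>
     (\<forall>h\<in>{1..horizon G}.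
        reward G h \<in> borel_measurable (data_space G) \<and>
        (\<forall>x\<in>space (data_space G). 0 \<le> reward G h x \<and> reward G h x \<le> 1) \<and>
        (\<forall>f\<in>models G. trans G f h \<in> data_space G \<rightarrow>\<^sub>M prob_algebra (states G)))"

definition max_policies :: "('s, 'a, 'b, 'f) game \<Rightarrow> ('s, 'a) policy set" where
  "max_policies G = {\<pi>. \<forall>h\<in>{1..horizon G}. \<pi> h \<in> states G \<rightarrow>\<^sub>M prob_algebra (acts_max G)}"

definition min_policies :: "('s, 'a, 'b, 'f) game \<Rightarrow> ('s, 'b) policy set" where
  "min_policies G = {\<nu>. \<forall>h\<in>{1..horizon G}. \<nu> h \<in> states G \<rightarrow>\<^sub>M prob_algebra (acts_min G)}"

text \<open>The players randomise independently given the current state.\<close>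

definition play :: "('s, 'a, 'b, 'f) game \<Rightarrow> ('s, 'a) policy \<Rightarrow> ('s, 'b) policy \<Rightarrow>
    nat \<Rightarrow> 's \<Rightarrow> ('s \<times> 'a \<times> 'b) measure" where
  "play G \<pi> \<nu> h s = distr (\<pi> h s \<Otimes>\<^sub>M \<nu> h s) (data_space G) (\<lambda>(a, b). (s, a, b))"

text \<open>\<open>state_law G f \<pi> \<nu> h s n\<close> is the law of \<open>s\<^bsub>h+n\<^esub>\<close> under model \<open>f\<close> given \<open>s\<^bsub>h\<^esub> = s\<close>.\<close>

primrec state_law :: "('s, 'a, 'b, 'f) game \<Rightarrow> 'f \<Rightarrow> ('s, 'a) policy \<Rightarrow> ('s, 'b) policy \<Rightarrow>
    nat \<Rightarrow> 's \<Rightarrow> nat \<Rightarrow> 's measure" where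
  "state_law G f \<pi> \<nu> h s 0 = return (states G) s"
| "state_law G f \<pi> \<nu> h s (Suc n) =
     state_law G f \<pi> \<nu> h s n \<bind> (\<lambda>s'. play G \<pi> \<nu> (h + n) s' \<bind> trans G f (h + n))"

text \<open>For \<open>h \<le> k\<close>: the law of \<open>(s\<^sub>k, a\<^sub>k, b\<^sub>k)\<close> under model \<open>f\<close> given \<open>s\<^bsub>h\<^esub> = s\<close>.\<close>

definition data_law :: "('s, 'a, 'b, 'f) game \<Rightarrow> 'f \<Rightarrow> ('s, 'a) policy \<Rightarrow> ('s, 'b) policy \<Rightarrow>
    nat \<Rightarrow> 's \<Rightarrow> nat \<Rightarrow> ('s \<times> 'a \<times> 'b) measure" where
  "data_law G f \<pi> \<nu> h s k = state_law G f \<pi> \<nu> h s (k - h) \<bind> play G \<pi> \<nu> k"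

definition V_step :: "('s, 'a, 'b, 'f) game \<Rightarrow> 'f \<Rightarrow> ('s, 'a) policy \<Rightarrow> ('s, 'b) policy \<Rightarrow>
    nat \<Rightarrow> 's \<Rightarrow> real" where
  "V_step G f \<pi> \<nu> h s =
     (\<Sum>k\<in>{h..horizon G}. LINT x|data_law G f \<pi> \<nu> h s k. reward G k x)"

definition Q_step :: "('s, 'a, 'b, 'f) game \<Rightarrow> 'f \<Rightarrow> ('s, 'a) policy \<Rightarrow> ('s, 'b) policy \<Rightarrow>
    nat \<Rightarrow> 's \<times> 'a \<times> 'b \<Rightarrow> real" where
  "Q_step G f \<pi> \<nu> h x = reward G h x + (LINT s'|trans G f h x. V_step G f \<pi> \<nu> (h + 1) s')"

definition game_value :: "('s, 'a, 'b, 'f) game \<Rightarrow> 'f \<Rightarrow> ('s, 'a) policy \<Rightarrow> ('s, 'b) policy \<Rightarrow>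
    real" where
  "game_value G f \<pi> \<nu> = V_step G f \<pi> \<nu> 1 (init G)"

text \<open>Law of the data point \<open>\<xi>\<^sub>h = (s\<^sub>h, a\<^sub>h, b\<^sub>h)\<close> when \<open>(\<pi>, \<nu>)\<close> is executed in the true model.\<close>

definition true_law :: "('s, 'a, 'b, 'f) game \<Rightarrow> ('s, 'a) policy \<Rightarrow> ('s, 'b) policy \<Rightarrow>
    nat \<Rightarrow> ('s \<times> 'a \<times> 'b) measure" where
  "true_law G \<pi> \<nu> h = data_law G (truth G) \<pi> \<nu> 1 (init G) h"

definition bellman_residual :: "('s, 'a, 'b, 'f) game \<Rightarrow> 'f \<Rightarrow> ('s, 'a) policy \<Rightarrow>
    ('s, 'b) policy \<Rightarrow> nat \<Rightarrow> real" where
  "bellman_residual G f \<pi> \<nu> h =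
     (LINT x|true_law G \<pi> \<nu> h.
        Q_step G f \<pi> \<nu> h x
        - (LINT s'|trans G (truth G) h x. reward G h x + V_step G f \<pi> \<nu> (h + 1) s'))"

section \<open>Self-play policy pairs\<close>

text \<open>
  \<open>Max_Main\<close> is the rule \<open>\<pi> = argmax\<^sub>\<pi> min\<^sub>\<nu> V\<^sub>f\<close>, \<open>\<nu> = argmin\<^sub>\<nu> V\<^sub>g\<close>; \<open>Min_Main\<close> is its mirror image
  with the roles of the players exchanged.  A set \<open>R\<close> of rules admits a pair that obeys one of
  its members.  Equations \<open>\<pi> = argmax ...\<close> mean that \<open>\<pi>\<close> is some optimiser.
\<close>

datatype main_player = Max_Main | Min_Main

fun obeys :: "('s, 'a, 'b, 'f) game \<Rightarrow> 'f \<Rightarrow> 'f \<Rightarrow> ('s, 'a) policy \<Rightarrow> ('s, 'b) policy \<Rightarrow>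
    main_player \<Rightarrow> bool" where
  "obeys G f g \<pi> \<nu> Max_Main \<longleftrightarrow>
     is_arg_max (\<lambda>\<pi>'. INF \<nu>'\<in>min_policies G. game_value G f \<pi>' \<nu>') (\<lambda>\<pi>'. \<pi>' \<in> max_policies G) \<pi> \<and>
     is_arg_min (\<lambda>\<nu>'. game_value G g \<pi> \<nu>') (\<lambda>\<nu>'. \<nu>' \<in> min_policies G) \<nu>"
| "obeys G f g \<pi> \<nu> Min_Main \<longleftrightarrow>
     is_arg_min (\<lambda>\<nu>'. SUP \<pi>'\<in>max_policies G. game_value G f \<pi>' \<nu>') (\<lambda>\<nu>'. \<nu>' \<in> min_policies G) \<nu> \<and>
     is_arg_max (\<lambda>\<pi>'. game_value G g \<pi>' \<nu>) (\<lambda>\<pi>'. \<pi>' \<in> max_policies G) \<pi>"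

definition self_play_pair :: "main_player set \<Rightarrow> ('s, 'a, 'b, 'f) game \<Rightarrow> 'f \<Rightarrow> 'f \<Rightarrow>
    ('s, 'a) policy \<Rightarrow> ('s, 'b) policy \<Rightarrow> bool" where
  "self_play_pair R G f g \<pi> \<nu> \<longleftrightarrow> (\<exists>m\<in>R. obeys G f g \<pi> \<nu> m)"

section \<open>Self-play witness rank\<close>

definition discriminator_class :: "('s, 'a, 'b, 'f) game \<Rightarrow>
    (('s \<times> 'a \<times> 'b) \<times> 's \<Rightarrow> real) set \<Rightarrow> bool" where
  "discriminator_class G U \<longleftrightarrow> U \<noteq> {} \<and>
     (\<forall>u\<in>U. u \<in> borel_measurable (data_space G \<Otimes>\<^sub>M states G) \<and>
       (\<forall>z\<in>space (data_space G \<Otimes>\<^sub>M states G). 0 \<le> u z \<and> u z \<le> real (horizon G)))"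

definition model_misfit :: "('s, 'a, 'b, 'f) game \<Rightarrow> (('s \<times> 'a \<times> 'b) \<times> 's \<Rightarrow> real) set \<Rightarrow>
    ('s, 'a) policy \<Rightarrow> ('s, 'b) policy \<Rightarrow> 'f \<Rightarrow> nat \<Rightarrow> real" where
  "model_misfit G U \<pi> \<nu> \<rho> h =
     (SUP u\<in>U. \<bar>LINT x|true_law G \<pi> \<nu> h.
        (LINT s'|trans G \<rho> h x. u (x, s')) - (LINT s'|trans G (truth G) h x. u (x, s'))\<bar>)"

definition witness_factorization :: "main_player set \<Rightarrow> ('s, 'a, 'b, 'f) game \<Rightarrow>
    (('s \<times> 'a \<times> 'b) \<times> 's \<Rightarrow> real) set \<Rightarrow>
    (nat \<Rightarrow> 'f \<Rightarrow> 'f \<Rightarrow> real ^ 'd) \<Rightarrow> (nat \<Rightarrow> 'f \<Rightarrow> real ^ 'd) \<Rightarrow> real \<Rightarrow> real \<Rightarrow> bool" where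
  "witness_factorization R G U W X \<kappa> B \<longleftrightarrow>
     (\<forall>h\<in>{1..horizon G}. \<forall>f\<in>models G. \<forall>g\<in>models G. \<forall>\<rho>\<in>models G.
        norm (W h f g) \<le> real (horizon G) * B \<and> norm (X h \<rho>) \<le> 1 \<and>
        (\<forall>\<pi> \<nu>. self_play_pair R G f g \<pi> \<nu> \<longrightarrow>
           \<kappa> * \<bar>bellman_residual G \<rho> \<pi> \<nu> h\<bar> \<le> W h f g \<bullet> X h \<rho> \<and>
           W h f g \<bullet> X h \<rho> \<le> model_misfit G U \<pi> \<nu> \<rho> h))"

text \<open>The rank \<open>d\<close> is the cardinality of the index type \<open>'d\<close>.\<close>

definition low_witness_rank_games :: "main_player set \<Rightarrow> nat \<Rightarrow> 'd::finite itself \<Rightarrow>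
    real \<Rightarrow> real \<Rightarrow> ('s, 'a, 'b, 'f) game set" where
  "low_witness_rank_games R H d \<kappa> B =
     {G. markov_game G \<and> horizon G = H \<and>
         (\<exists>U (W :: nat \<Rightarrow> 'f \<Rightarrow> 'f \<Rightarrow> real ^ 'd) X.
            discriminator_class G U \<and> witness_factorization R G U W X \<kappa> B)}"

section \<open>Self-play generalized eluder coefficient\<close>

text \<open>
  Losses are nonnegative.  Their expectation is taken with \<open>nn_integral\<close>, which for a
  loss measurable in the data point is the ordinary expectation, and which stays meaningful (as
  a lower integral) without such a measurability assumption.
\<close>

definition expected_loss :: "('s, 'a, 'b, 'f) game \<Rightarrow> (nat \<Rightarrow> 'f \<Rightarrow> 's \<times> 'a \<times> 'b \<Rightarrow> real) \<Rightarrow>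
    ('s, 'a) policy \<Rightarrow> ('s, 'b) policy \<Rightarrow> nat \<Rightarrow> 'f \<Rightarrow> real" where
  "expected_loss G l \<pi> \<nu> h \<rho> = enn2real (\<integral>\<^sup>+x. ennreal (l h \<rho> x) \<partial>true_law G \<pi> \<nu> h)"

definition GEC_constants :: "main_player set \<Rightarrow> ('s, 'a, 'b, 'f) game \<Rightarrow>
    (nat \<Rightarrow> 'f \<Rightarrow> 's \<times> 'a \<times> 'b \<Rightarrow> real) \<Rightarrow> nat \<Rightarrow> real \<Rightarrow> real set" where
  "GEC_constants R G l T \<epsilon> = {D. 0 \<le> D \<and>
     (\<forall>f g \<pi> \<nu>.
        (\<forall>t\<in>{1..T}. f t \<in> models G \<and> g t \<in> models G \<and>
                    self_play_pair R G (f t) (g t) (\<pi> t) (\<nu> t)) \<longrightarrow>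
        (\<forall>\<rho>\<in>{f, g}.
           \<bar>\<Sum>t = 1..T. game_value G (\<rho> t) (\<pi> t) (\<nu> t) - game_value G (truth G) (\<pi> t) (\<nu> t)\<bar>
           \<le> sqrt (D * (\<Sum>h = 1..horizon G. \<Sum>t = 1..T. \<Sum>\<tau> = 1..<t.
                           expected_loss G l (\<pi> \<tau>) (\<nu> \<tau>) h (\<rho> t)))
             + 2 * real (horizon G) * sqrt (D * real (horizon G) * real T)
             + \<epsilon> * real (horizon G) * real T))}"

definition is_self_play_GEC :: "main_player set \<Rightarrow> ('s, 'a, 'b, 'f) game \<Rightarrow>
    (nat \<Rightarrow> 'f \<Rightarrow> 's \<times> 'a \<times> 'b \<Rightarrow> real) \<Rightarrow> nat \<Rightarrow> real \<Rightarrow> real \<Rightarrow> bool" where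
  "is_self_play_GEC R G l T \<epsilon> D \<longleftrightarrow>
     D \<in> GEC_constants R G l T \<epsilon> \<and> (\<forall>D'\<in>GEC_constants R G l T \<epsilon>. D \<le> D')"

definition hellinger_loss :: "('s, 'a, 'b, 'f) game \<Rightarrow> nat \<Rightarrow> 'f \<Rightarrow> 's \<times> 'a \<times> 'b \<Rightarrow> real" where
  "hellinger_loss G h f x = hellinger2 (trans G f h x) (trans G (truth G) h x)"

definition low_GEC_games :: "main_player set \<Rightarrow> nat \<Rightarrow> nat \<Rightarrow> real \<Rightarrow> real \<Rightarrow>
    ('s, 'a, 'b, 'f) game set" where
  "low_GEC_games R H T \<epsilon> D =
     {G. markov_game G \<and> horizon G = H \<and>
         (\<exists>d. is_self_play_GEC R G (hellinger_loss G) T \<epsilon> d \<and> d \<le> D)}"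

lemma GEC_constants_upward_closed:
  assumes "D \<in> GEC_constants R G l T \<epsilon>" and "D \<le> D'"
  shows "D' \<in> GEC_constants R G l T \<epsilon>"
proof -
  have D: "0 \<le> D" using assms(1) by (simp add: GEC_constants_def)
  have nn: "0 \<le> (\<Sum>h = 1..horizon G. \<Sum>t = 1..T. \<Sum>\<tau> = 1..<t.
              expected_loss G l (\<pi> \<tau>) (\<nu> \<tau>) h (\<rho> t))" for \<pi> \<nu> and \<rho> :: "nat \<Rightarrow> 'd"
    by (intro sum_nonneg) (simp add: expected_loss_def)
  have mono: "sqrt (D * S) + 2 * real (horizon G) * sqrt (D * real (horizon G) * real T) + c
      \<le> sqrt (D' * S) + 2 * real (horizon G) * sqrt (D' * real (horizon G) * real T) + c"
    if "0 \<le> S" for S c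
    using that assms(2) by (intro add_mono mult_left_mono) (auto intro!: mult_right_mono)
  show ?thesis
    unfolding GEC_constants_def mem_Collect_eq
  proof (intro conjI allI impI ballI)
    show "0 \<le> D'" using D assms(2) by simp
  next
    fix f g \<rho> :: "nat \<Rightarrow> 'd" and \<pi> \<nu>
    assume "\<forall>t\<in>{1..T}. f t \<in> models G \<and> g t \<in> models G \<and>
              self_play_pair R G (f t) (g t) (\<pi> t) (\<nu> t)" and "\<rho> \<in> {f, g}"
    with assms(1) have
      "\<bar>\<Sum>t = 1..T. game_value G (\<rho> t) (\<pi> t) (\<nu> t) - game_value G (truth G) (\<pi> t) (\<nu> t)\<bar>
           \<le> sqrt (D * (\<Sum>h = 1..horizon G. \<Sum>t = 1..T. \<Sum>\<tau> = 1..<t.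
                           expected_loss G l (\<pi> \<tau>) (\<nu> \<tau>) h (\<rho> t)))
             + 2 * real (horizon G) * sqrt (D * real (horizon G) * real T)
             + \<epsilon> * real (horizon G) * real T"
      unfolding GEC_constants_def mem_Collect_eq by blast
    also note mono[OF nn]
    finally show "\<bar>\<Sum>t = 1..T. game_value G (\<rho> t) (\<pi> t) (\<nu> t) - game_value G (truth G) (\<pi> t) (\<nu> t)\<bar>
           \<le> sqrt (D' * (\<Sum>h = 1..horizon G. \<Sum>t = 1..T. \<Sum>\<tau> = 1..<t.
                           expected_loss G l (\<pi> \<tau>) (\<nu> \<tau>) h (\<rho> t)))
             + 2 * real (horizon G) * sqrt (D' * real (horizon G) * real T)
             + \<epsilon> * real (horizon G) * real T" .
  qed
qed

lemma closed_GEC_constants: "closed (GEC_constants R G l T \<epsilon>)"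
  unfolding GEC_constants_def imp_conv_disj Ball_def
  by (intro closed_Collect_conj closed_Collect_all closed_Collect_disj closed_Collect_const
      closed_Collect_le continuous_intros)

text \<open>The minimal constant exists as soon as some constant is admissible.\<close>

lemma low_GEC_games_iff:
  "G \<in> low_GEC_games R H T \<epsilon> D \<longleftrightarrow>
     markov_game G \<and> horizon G = H \<and> D \<in> GEC_constants R G (hellinger_loss G) T \<epsilon>"
proof -
  let ?C = "GEC_constants R G (hellinger_loss G) T \<epsilon>"
  have "(\<exists>d. is_self_play_GEC R G (hellinger_loss G) T \<epsilon> d \<and> d \<le> D) \<longleftrightarrow> D \<in> ?C"
  proof
    assume "D \<in> ?C"
    moreover have bdd: "bdd_below ?C"
      by (rule bdd_belowI[of _ 0]) (simp add: GEC_constants_def)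
    ultimately have "Inf ?C \<in> ?C" "\<forall>D'\<in>?C. Inf ?C \<le> D'"
      using closed_contains_Inf[OF _ bdd closed_GEC_constants] by (auto intro: cInf_lower)
    with \<open>D \<in> ?C\<close> show "\<exists>d. is_self_play_GEC R G (hellinger_loss G) T \<epsilon> d \<and> d \<le> D"
      unfolding is_self_play_GEC_def by blast
  qed (auto simp: is_self_play_GEC_def intro: GEC_constants_upward_closed)
  then show ?thesis by (simp add: low_GEC_games_def)
qed

end

(*
  The value difference of a model and the truth under a fixed policy pair is the sum over the
  steps of the Bellman residuals.  The witness factorisation bounds a residual by
  <W(f^t,g^t), X(rho^t)> / kappa, and for tau < t it bounds <W(f^tau,g^tau), X(rho^t)> by the
  model misfit, whose square is at most 8 H^2 times the expected squared Hellinger distance.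

  What remains is to bound sum_t |<w_t, x_t>| by the square root of
  sum_t sum_{tau<t} <w_tau, x_t>^2.  Instead of the elliptical potential lemma, which would be the
  usual source of the factor d log(1 + ...), a pigeonhole argument gives
  delta T + C + C sqrt(...) with C independent of T for every delta > 0.  With
  delta = kappa epsilon / 2 the first two terms are absorbed by epsilon H T, and C by d_GEC, since
  d_GEC tends to infinity with T unless B = 0, in which case W = 0.
*)

theory Submission
  imports Defs "HOL-Real_Asymp.Real_Asymp"
begin

section \<open>Sums of inner products\<close>

text \<open>Cauchy-Schwarz against the constant 1. It moves the square root outside a sum over
  rounds at the price of the number of rounds, which a threshold proportional to \<open>T\<close>
  later cancels.\<close>

lemma sum_sqrt_le:
  fixes S :: "'i \<Rightarrow> real"
  assumes "\<And>i. i \<in> A \<Longrightarrow> 0 \<le> S i"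
  shows "(\<Sum>i\<in>A. sqrt (S i)) \<le> sqrt (real (card A) * (\<Sum>i\<in>A. S i))"
proof (rule real_le_rsqrt)
  have "(\<Sum>i\<in>A. sqrt (S i) * 1)\<^sup>2 \<le> (\<Sum>i\<in>A. (sqrt (S i))\<^sup>2) * (\<Sum>i\<in>A. 1\<^sup>2)"
    by (rule Cauchy_Schwarz_ineq_sum)
  also have "(\<Sum>i\<in>A. (sqrt (S i))\<^sup>2) = (\<Sum>i\<in>A. S i)"
    using assms by (intro sum.cong) auto
  finally show "(\<Sum>i\<in>A. sqrt (S i))\<^sup>2 \<le> real (card A) * (\<Sum>i\<in>A. S i)"
    by (simp add: mult.commute)
qed

text \<open>Within one colour the number of earlier indices of that colour strictly increases, so it
  determines the index, and at most \<open>m + 1\<close> natural numbers are bounded by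
  \<open>m\<close>. Summing over the colours gives the bound. The colours will be the cells of a
  net.\<close>

lemma card_few_earlier_same_colour:
  fixes col :: "nat \<Rightarrow> 'c" and m :: real
  assumes "0 \<le> m" and fin: "finite K" and col: "\<And>t. t \<in> {1..T} \<Longrightarrow> col t \<in> K"
  shows "real (card {t \<in> {1..T}. real (card {\<tau> \<in> {1..<t}. col \<tau> = col t}) < m}) \<le> real (card K) * (m + 1)"
proof -
  let ?n = "\<lambda>t. card {\<tau> \<in> {1..<t}. col \<tau> = col t}"
  let ?B = "\<lambda>k. {t \<in> {1..T}. col t = k \<and> real (?n t) < m}"
  have strict: "?n s < ?n t" if "s \<in> {1..T}" "col s = col t" "s < t" for s t
  proof (rule psubset_card_mono)
    have "s \<in> {\<tau> \<in> {1..<t}. col \<tau> = col t}" "s \<notin> {\<tau> \<in> {1..<s}. col \<tau> = col s}"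
      using that by auto
    moreover have "{\<tau> \<in> {1..<s}. col \<tau> = col s} \<subseteq> {\<tau> \<in> {1..<t}. col \<tau> = col t}"
      using that by auto
    ultimately show "{\<tau> \<in> {1..<s}. col \<tau> = col s} \<subset> {\<tau> \<in> {1..<t}. col \<tau> = col t}"
      by blast
  qed simp
  have cell: "real (card (?B k)) \<le> m + 1" for k
  proof -
    have "inj_on ?n (?B k)"
    proof (rule inj_onI)
      fix s t assume st: "s \<in> ?B k" "t \<in> ?B k" and eq: "?n s = ?n t"
      have "col s = col t" using st by simp
      with strict[of s t] strict[of t s] st eq show "s = t"
        by (cases s t rule: linorder_cases) auto
    qed
    moreover have "?n ` ?B k \<subseteq> {..nat \<lfloor>m\<rfloor>}"
    proof (rule image_subsetI)
      fix t assume "t \<in> ?B k"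
      then have "real (?n t) < m" by blast
      then have "real (?n t) \<le> m" by (rule less_imp_le)
      then show "?n t \<in> {..nat \<lfloor>m\<rfloor>}" unfolding atMost_iff by (rule le_nat_floor)
    qed
    ultimately have "card (?B k) \<le> card {..nat \<lfloor>m\<rfloor>}"
      by (rule card_inj_on_le) simp
    then show ?thesis using \<open>0 \<le> m\<close> by simp linarith
  qed
  have "{t \<in> {1..T}. real (?n t) < m} \<subseteq> (\<Union>k\<in>K. ?B k)" using col by blast
  then have "card {t \<in> {1..T}. real (?n t) < m} \<le> card (\<Union>k\<in>K. ?B k)"
    by (intro card_mono) (use fin in auto)
  also have "\<dots> \<le> (\<Sum>k\<in>K. card (?B k))" by (rule card_UN_le[OF fin])
  finally have "real (card {t \<in> {1..T}. real (?n t) < m}) \<le> (\<Sum>k\<in>K. real (card (?B k)))"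
    unfolding of_nat_sum[symmetric] by (rule of_nat_mono)
  also have "\<dots> \<le> (\<Sum>k\<in>K. m + 1)" by (intro sum_mono cell)
  finally show ?thesis by simp
qed

text \<open>
  Cut the ball of radius \<open>W\<close> into finitely many small cells.  If \<open>m = c T\<close> earlier vectors
  lie in the cell of \<open>w\<^sub>t\<close> and \<open>\<bar>w\<^sub>t \<bullet> x\<^sub>t\<bar>\<close> is not small, each of them has inner product at least
  \<open>\<bar>w\<^sub>t \<bullet> x\<^sub>t\<bar> / 2\<close> with \<open>x\<^sub>t\<close>, so that \<open>\<bar>w\<^sub>t \<bullet> x\<^sub>t\<bar>\<^sup>2 \<le> 4 S\<^sub>t / (c T)\<close>.  At most about \<open>c T\<close>
  steps per cell have fewer predecessors.  The threshold is proportional to \<open>T\<close> because this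
  keeps the coefficient of the square root free of a factor \<open>ln T\<close>.
\<close>

lemma sum_inner_le_earlier_squares:
  fixes W \<delta> :: real
  assumes "0 < \<delta>" "0 \<le> W"
  obtains C where "0 < C"
    and "\<And>T (w :: nat \<Rightarrow> 'a::euclidean_space) x.
      (\<And>t. t \<in> {1..T} \<Longrightarrow> norm (w t) \<le> W \<and> norm (x t) \<le> 1) \<Longrightarrow>
      (\<Sum>t=1..T. \<bar>w t \<bullet> x t\<bar>) \<le>
        \<delta> * real T + C + C * sqrt (\<Sum>t=1..T. \<Sum>\<tau>=1..<t. (w \<tau> \<bullet> x t)\<^sup>2)"
proof -
  \<comment> \<open>The closed ball is totally bounded. With radius \<open>\<delta>/8\<close>, two
    vectors of one cell are less than \<open>\<delta>/4\<close> apart, so their inner products with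
    a vector of norm at most 1 differ by at most \<open>\<delta>/4\<close>.\<close>
  obtain K :: "'a set" where K: "finite K" "cball 0 W \<subseteq> (\<Union>k\<in>K. ball k (\<delta>/8))"
    using compact_cball[of "0::'a" W, unfolded compact_eq_totally_bounded] assms(1)
    by (metis zero_less_divide_iff zero_less_numeral)
  then have "\<forall>w. \<exists>k. w \<in> cball 0 W \<longrightarrow> k \<in> K \<and> w \<in> ball k (\<delta>/8)" by blast
  then obtain net where net: "\<And>w. w \<in> cball 0 W \<Longrightarrow> net w \<in> K \<and> w \<in> ball (net w) (\<delta>/8)"
    by metis
  define N where "N = real (card K)"
  \<comment> \<open>Rounds with few predecessors will cost about \<open>N * W * c * T\<close>. This
    \<open>c\<close> keeps that below \<open>\<delta>/2 * T\<close>, leaving the other half for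
    rounds with a small inner product. The summand 1 guards against \<open>W = 0\<close>.\<close>
  define c where "c = \<delta> / (2 * (N * W + 1))"
  have N: "0 \<le> N" by (simp add: N_def)
  have NW: "0 \<le> N * W" using N assms by simp
  have c: "0 < c" using NW assms by (simp add: c_def add_pos_nonneg)
  have "N * W * c = \<delta> / 2 * (N * W / (N * W + 1))" by (simp add: c_def)
  also have "\<dots> \<le> \<delta> / 2 * 1" using NW assms by (intro mult_left_mono) auto
  finally have NWc: "N * W * c \<le> \<delta> / 2" by simp
  \<comment> \<open>\<open>N * W\<close> pays for the \<open>+ 1\<close> in the count per cell, and
    \<open>2 / sqrt c\<close> is the coefficient of the square root.\<close>
  define C where "C = N * W + 2 / sqrt c"
  have C: "0 < C" "N * W \<le> C" "2 / sqrt c \<le> C" using NW c by (auto simp: C_def add_nonneg_pos)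
  show thesis
  proof (rule that[OF C(1)])
    fix T and w x :: "nat \<Rightarrow> 'a"
    assume wx: "\<And>t. t \<in> {1..T} \<Longrightarrow> norm (w t) \<le> W \<and> norm (x t) \<le> 1"
    define S where "S t = (\<Sum>\<tau>=1..<t. (w \<tau> \<bullet> x t)\<^sup>2)" for t
    have S: "0 \<le> S t" for t by (simp add: S_def sum_nonneg)
    define n where "n t = card {\<tau> \<in> {1..<t}. net (w \<tau>) = net (w t)}" for t
    define m where "m = c * real T"
    show "(\<Sum>t=1..T. \<bar>w t \<bullet> x t\<bar>) \<le>
        \<delta> * real T + C + C * sqrt (\<Sum>t=1..T. \<Sum>\<tau>=1..<t. (w \<tau> \<bullet> x t)\<^sup>2)"
    proof (cases "T = 0")
      case True then show ?thesis using C by simp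
    next
      case False
      then have m: "0 < m" using c by (simp add: m_def)
      \<comment> \<open>Each summand on the right covers one case: a small inner product, few
        predecessors in the same cell, and otherwise at least \<open>m\<close> predecessors whose
        inner product with \<open>x t\<close> is at least half as large.\<close>
      have each: "\<bar>w t \<bullet> x t\<bar> \<le> \<delta> / 2 + W * of_bool (real (n t) < m) + 2 * sqrt (S t / m)"
        if t: "t \<in> {1..T}" for t
      proof -
        define y where "y = \<bar>w t \<bullet> x t\<bar>"
        have yW: "y \<le> W"
        proof -
          have "y \<le> norm (w t) * norm (x t)" unfolding y_def by (rule Cauchy_Schwarz_ineq2)
          also have "\<dots> \<le> W * 1" using wx[OF t] assms by (intro mult_mono) auto
          finally show ?thesis by simp
        qed
        have sq: "0 \<le> 2 * sqrt (S t / m)" "0 \<le> W * of_bool (real (n t) < m)"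
          using S m assms by auto
        consider "y \<le> \<delta>/2" | "real (n t) < m" | "\<delta>/2 < y" "m \<le> real (n t)" by linarith
        then have "y \<le> \<delta> / 2 + W * of_bool (real (n t) < m) + 2 * sqrt (S t / m)"
        proof cases
          case 3
          have near: "(y/2)\<^sup>2 \<le> (w \<tau> \<bullet> x t)\<^sup>2" if \<tau>: "\<tau> \<in> {1..<t}" "net (w \<tau>) = net (w t)" for \<tau>
          proof -
            have "w \<tau> \<in> cball 0 W" "w t \<in> cball 0 W" using wx[of \<tau>] wx[OF t] \<tau> t by auto
            from net[OF this(1)] net[OF this(2)] \<tau>(2)
            have "dist (w \<tau>) (w t) < \<delta>/8 + \<delta>/8"
              by (metis add_strict_mono dist_commute dist_triangle_less_add mem_ball)
            have "\<bar>(w t - w \<tau>) \<bullet> x t\<bar> \<le> norm (w t - w \<tau>) * norm (x t)"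
              by (rule Cauchy_Schwarz_ineq2)
            also have "\<dots> \<le> (\<delta>/4) * 1"
              using wx[OF t] assms \<open>dist (w \<tau>) (w t) < \<delta>/8 + \<delta>/8\<close>
              by (intro mult_mono) (auto simp: dist_norm norm_minus_commute)
            finally have "y / 2 \<le> \<bar>w \<tau> \<bullet> x t\<bar>"
              using 3 unfolding y_def inner_diff_left by linarith
            then show ?thesis by (metis abs_le_square_iff abs_of_nonneg abs_ge_zero y_def
                  divide_nonneg_pos zero_less_numeral)
          qed
          have "m * (y/2)\<^sup>2 \<le> real (n t) * (y/2)\<^sup>2" using 3 by (intro mult_right_mono) auto
          also have "\<dots> = (\<Sum>\<tau> | \<tau> \<in> {1..<t} \<and> net (w \<tau>) = net (w t). (y/2)\<^sup>2)" by (simp add: n_def)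
          also have "\<dots> \<le> (\<Sum>\<tau> | \<tau> \<in> {1..<t} \<and> net (w \<tau>) = net (w t). (w \<tau> \<bullet> x t)\<^sup>2)"
            by (intro sum_mono near) auto
          also have "\<dots> \<le> S t" unfolding S_def by (rule sum_mono2) auto
          finally have "(y/2)\<^sup>2 \<le> S t / m" using m by (simp add: field_simps)
          then have "y / 2 \<le> sqrt (S t / m)" by (rule real_le_rsqrt)
          then show ?thesis using assms sq by linarith
        next
          case 1 then show ?thesis using sq by linarith
        next
          case 2
          then have "W * of_bool (real (n t) < m) = W" by simp
          then show ?thesis using yW sq(1) assms by linarith
        qed
        then show ?thesis by (simp add: y_def)
      qed
      have few: "(\<Sum>t=1..T. of_bool (real (n t) < m)) \<le> N * (m + 1)"
      proof -
        have "(\<Sum>t=1..T. of_bool (real (n t) < m)) = real (card {t \<in> {1..T}. real (n t) < m})"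
          by (subst sum_of_bool_eq) (auto intro!: arg_cong[where f = card])
        also have "\<dots> \<le> N * (m + 1)"
          unfolding N_def n_def using m K(1)
          by (intro card_few_earlier_same_colour) (use net wx in auto)
        finally show ?thesis .
      qed
      have "(\<Sum>t=1..T. sqrt (S t / m)) \<le> sqrt (real (card {1..T}) * (\<Sum>t=1..T. S t / m))"
        using S m by (intro sum_sqrt_le) auto
      \<comment> \<open>The factor \<open>T\<close> from Cauchy-Schwarz cancels against
        \<open>m = c * T\<close>.\<close>
      also have "real (card {1..T}) * (\<Sum>t=1..T. S t / m) = (\<Sum>t=1..T. S t) / c"
        unfolding sum_divide_distrib[symmetric] using False c by (simp add: m_def)
      finally have roots: "(\<Sum>t=1..T. sqrt (S t / m)) \<le> sqrt (\<Sum>t=1..T. S t) / sqrt c"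
        by (simp add: real_sqrt_divide)
      have "(\<Sum>t=1..T. \<bar>w t \<bullet> x t\<bar>) \<le>
          (\<Sum>t=1..T. \<delta> / 2 + W * of_bool (real (n t) < m) + 2 * sqrt (S t / m))"
        by (intro sum_mono each)
      also have "\<dots> = \<delta> / 2 * real T + W * (\<Sum>t=1..T. of_bool (real (n t) < m))
          + 2 * (\<Sum>t=1..T. sqrt (S t / m))"
        unfolding sum.distrib sum_distrib_left[symmetric] by simp
      also have "\<dots> \<le> \<delta> / 2 * real T + W * (N * (m + 1)) + 2 * (sqrt (\<Sum>t=1..T. S t) / sqrt c)"
        using few roots assms by (intro add_mono mult_left_mono) auto
      also have "\<dots> = \<delta> / 2 * real T + (N * W * c) * real T + N * W
          + 2 / sqrt c * sqrt (\<Sum>t=1..T. S t)"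
        unfolding m_def by (simp add: distrib_left distrib_right mult_ac)
      also have "\<dots> \<le> \<delta> / 2 * real T + \<delta> / 2 * real T + C + C * sqrt (\<Sum>t=1..T. S t)"
      proof -
        have "N * W * c * real T \<le> \<delta> / 2 * real T" using NWc by (rule mult_right_mono) simp
        moreover have "2 / sqrt c * sqrt (\<Sum>t=1..T. S t) \<le> C * sqrt (\<Sum>t=1..T. S t)"
          using C(3) by (rule mult_right_mono) (simp add: S sum_nonneg)
        ultimately show ?thesis using C(2) by linarith
      qed
      finally show ?thesis by (simp add: S_def)
    qed
  qed
qed

section \<open>Hellinger distance\<close>

text \<open>Cauchy-Schwarz with an upper bound \<open>c\<close> in place of the second moment of
  \<open>g\<close>. With \<open>b\<close> the integral of \<open>f * g\<close> and \<open>F\<close>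
  that of the square of \<open>f\<close>, integrating the square of \<open>c * f - b * g\<close>
  gives a value between 0 and \<open>c * (c * F - b\<^sup>2)\<close>. Since \<open>c\<close> is
  positive, it can be cancelled even if \<open>g\<close> vanishes almost everywhere.\<close>

lemma square_integral_mult_le:
  fixes f g :: "'a \<Rightarrow> real"
  assumes "integrable M (\<lambda>x. (f x)\<^sup>2)" "integrable M (\<lambda>x. (g x)\<^sup>2)"
    and "integrable M (\<lambda>x. f x * g x)" and "0 < c" and le: "(\<integral>x. (g x)\<^sup>2 \<partial>M) \<le> c"
  shows "(\<integral>x. f x * g x \<partial>M)\<^sup>2 \<le> c * (\<integral>x. (f x)\<^sup>2 \<partial>M)"
proof -
  define b where "b = (\<integral>x. f x * g x \<partial>M)"
  have "0 \<le> (\<integral>x. (c * f x - b * g x)\<^sup>2 \<partial>M)" by simp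
  also have "\<dots> = (\<integral>x. c\<^sup>2 * (f x)\<^sup>2 - 2 * c * b * (f x * g x) + b\<^sup>2 * (g x)\<^sup>2 \<partial>M)"
    by (intro Bochner_Integration.integral_cong) (auto simp: power2_eq_square algebra_simps)
  also have "\<dots> = c\<^sup>2 * (\<integral>x. (f x)\<^sup>2 \<partial>M) - 2 * c * b * b + b\<^sup>2 * (\<integral>x. (g x)\<^sup>2 \<partial>M)"
    using assms by (simp add: b_def)
  also have "\<dots> \<le> c\<^sup>2 * (\<integral>x. (f x)\<^sup>2 \<partial>M) - 2 * c * b * b + b\<^sup>2 * c"
    using le by (intro add_mono mult_left_mono) auto
  also have "\<dots> = c * (c * (\<integral>x. (f x)\<^sup>2 \<partial>M) - b\<^sup>2)" by (simp add: power2_eq_square algebra_simps)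
  finally show ?thesis using \<open>0 < c\<close> by (simp add: b_def zero_le_mult_iff)
qed

text \<open>With densities \<open>p\<close>, \<open>q\<close> relative to the sum of the measures,
  the squared difference of the roots is at most \<open>p + q\<close>, which integrates to 2. For
  the second claim, \<open>p - q\<close> factors into the difference and the sum of the roots. By
  Cauchy-Schwarz the difference contributes \<open>2 * hellinger2 P Q\<close>, and the sum times
  \<open>u\<close> contributes at most \<open>4 * c\<^sup>2\<close>, because the squared sum is at
  most \<open>2 * (p + q)\<close>.\<close>

lemma
  assumes P: "prob_space P" and Q: "prob_space Q" and sets_eq: "sets Q = sets P"
  shows hellinger2_le_1: "hellinger2 P Q \<le> 1"
    and square_diff_integrals_le_hellinger2:
      "\<lbrakk>u \<in> borel_measurable P; \<And>x. x \<in> space P \<Longrightarrow> \<bar>u x\<bar> \<le> c; 0 < c\<rbrakk> \<Longrightarrow>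
        ((\<integral>x. u x \<partial>P) - (\<integral>x. u x \<partial>Q))\<^sup>2 \<le> 8 * c\<^sup>2 * hellinger2 P Q"
proof -
  interpret P: prob_space P by (rule P)
  interpret Q: prob_space Q by (rule Q)
  define M where "M = sum_of_measures P Q"
  have sM [simp, measurable_cong]: "sets M = sets P" by (simp add: M_def)
  have spM: "space M = space P" by (simp add: M_def)
  have em: "emeasure M A = emeasure P A + emeasure Q A" if "A \<in> sets P" for A
    unfolding M_def by (rule emeasure_sum_of_measures[OF sets_eq that])
  have spQ: "space Q = space P" by (rule sets_eq_imp_space_eq[OF sets_eq])
  interpret M: finite_measure M
    by (rule finite_measureI)
      (use P.emeasure_space_1 Q.emeasure_space_1 in \<open>simp add: spM em spQ\<close>)
  \<comment> \<open>\<open>RN_deriv\<close> takes extended values. For a probability measure it is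
    finite almost everywhere, so the real-valued version is still a density.\<close>
  have density: "density M (\<lambda>x. ennreal (enn2real (RN_deriv M L x))) = L"
    if L: "prob_space L" "sets L = sets P" and ac: "absolutely_continuous M L" for L
  proof -
    interpret L: prob_space L by (rule L)
    have fin: "AE x in M. RN_deriv M L x \<noteq> \<infinity>"
      by (rule M.RN_deriv_finite[OF _ ac]) (simp_all add: L L.sigma_finite_measure_axioms)
    have "density M (\<lambda>x. ennreal (enn2real (RN_deriv M L x))) = density M (RN_deriv M L)"
      by (rule density_cong) (use fin in \<open>auto simp: less_top\<close>)
    then show ?thesis using M.density_RN_deriv[OF ac] L by simp
  qed
  have ac: "absolutely_continuous M P" "absolutely_continuous M Q"
    using em sets_eq by (auto simp: absolutely_continuous_def null_sets_def)
  define p where "p x = enn2real (RN_deriv M P x)" for x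
  define q where "q x = enn2real (RN_deriv M Q x)" for x
  have [measurable]: "p \<in> borel_measurable M" "q \<in> borel_measurable M"
    by (simp_all add: p_def[abs_def] q_def[abs_def])
  have nn: "0 \<le> p x" "0 \<le> q x" for x by (simp_all add: p_def q_def)
  have dP: "density M (\<lambda>x. ennreal (p x)) = P" and dQ: "density M (\<lambda>x. ennreal (q x)) = Q"
    unfolding p_def q_def using density[OF P _ ac(1)] density[OF Q sets_eq ac(2)] by simp_all
  have hell: "hellinger2 P Q = 1 / 2 * (\<integral>x. (sqrt (q x) - sqrt (p x))\<^sup>2 \<partial>M)"
    by (simp add: hellinger2_def M_def p_def q_def)
  have int: "integrable M p" "integrable M q" "(\<integral>x. p x \<partial>M) = 1" "(\<integral>x. q x \<partial>M) = 1"
  proof -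
    have "integrable (density M (\<lambda>x. ennreal (p x))) (\<lambda>x. 1::real)" by (simp add: dP)
    then show "integrable M p" by (subst (asm) integrable_density) (auto simp: nn)
    have "integrable (density M (\<lambda>x. ennreal (q x))) (\<lambda>x. 1::real)" by (simp add: dQ)
    then show "integrable M q" by (subst (asm) integrable_density) (auto simp: nn)
    have "(\<integral>x. 1 \<partial>density M (\<lambda>x. ennreal (p x))) = (1::real)" by (simp add: dP P.prob_space)
    then show "(\<integral>x. p x \<partial>M) = 1" by (subst (asm) integral_density) (auto simp: nn)
    have "(\<integral>x. 1 \<partial>density M (\<lambda>x. ennreal (q x))) = (1::real)" by (simp add: dQ Q.prob_space)
    then show "(\<integral>x. q x \<partial>M) = 1" by (subst (asm) integral_density) (auto simp: nn)
  qed
  have expand: "(sqrt (q x) - sqrt (p x))\<^sup>2 = p x + q x - 2 * (sqrt (p x) * sqrt (q x))"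
    "(sqrt (q x) + sqrt (p x))\<^sup>2 = p x + q x + 2 * (sqrt (p x) * sqrt (q x))" for x
    using nn[of x] by (simp_all add: power2_eq_square algebra_simps)
  have cross: "0 \<le> sqrt (p x) * sqrt (q x)" "2 * (sqrt (p x) * sqrt (q x)) \<le> p x + q x" for x
    using nn[of x] zero_le_power2[of "sqrt (q x) - sqrt (p x)"] unfolding expand by auto
  have int_diff: "integrable M (\<lambda>x. (sqrt (q x) - sqrt (p x))\<^sup>2)"
    by (rule Bochner_Integration.integrable_bound[of M "\<lambda>x. p x + q x"])
      (use int cross nn in \<open>auto simp: expand\<close>)
  have "(\<integral>x. (sqrt (q x) - sqrt (p x))\<^sup>2 \<partial>M) \<le> (\<integral>x. p x + q x \<partial>M)"
    by (rule integral_mono) (use int_diff int cross nn in \<open>auto simp: expand\<close>)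
  then show "hellinger2 P Q \<le> 1" using int by (simp add: hell)

  assume u: "u \<in> borel_measurable P" and bd: "\<And>x. x \<in> space P \<Longrightarrow> \<bar>u x\<bar> \<le> c" and "0 < c"
  then have [measurable]: "u \<in> borel_measurable M" by (simp cong: measurable_cong_sets)
  have bound: "\<bar>u x\<bar> \<le> c" "(u x)\<^sup>2 \<le> c\<^sup>2" if "x \<in> space M" for x
    using bd[of x] that \<open>0 < c\<close> by (auto simp: spM abs_le_square_iff[symmetric])
  have prod_int: "integrable M (\<lambda>x. r x * u x)" if "integrable M r" for r :: "'a \<Rightarrow> real"
  proof (rule Bochner_Integration.integrable_bound[of M "\<lambda>x. r x * c"])
    show "AE x in M. norm (r x * u x) \<le> norm (r x * c)"
      using bound(1) \<open>0 < c\<close> by (auto simp: abs_mult intro!: mult_left_mono)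
    show "(\<lambda>x. r x * u x) \<in> borel_measurable M"
      using that by measurable
  qed (use that in simp)
  note prod_int = prod_int[OF int(1)] prod_int[OF int(2)]
  \<comment> \<open>\<open>?f\<close> carries the Hellinger distance, while \<open>?g\<close>
    absorbs the test function and has a bounded second moment.\<close>
  let ?f = "\<lambda>x. sqrt (p x) - sqrt (q x)" and ?g = "\<lambda>x. (sqrt (q x) + sqrt (p x)) * u x"
  have fg: "?f x * ?g x = p x * u x - q x * u x" for x
  proof -
    have "?f x * (sqrt (q x) + sqrt (p x)) = p x - q x" using nn[of x] by (simp add: algebra_simps)
    then show ?thesis by (metis left_diff_distrib mult.assoc)
  qed
  have g_le: "(?g x)\<^sup>2 \<le> 2 * c\<^sup>2 * (p x + q x)" if "x \<in> space M" for x
  proof -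
    have "(?g x)\<^sup>2 = (sqrt (q x) + sqrt (p x))\<^sup>2 * (u x)\<^sup>2" by (simp add: power_mult_distrib)
    also have "\<dots> \<le> (2 * (p x + q x)) * c\<^sup>2"
      using cross[of x] nn[of x] bound[OF that] by (intro mult_mono) (auto simp: expand)
    finally show ?thesis by (simp add: algebra_simps)
  qed
  have int_g: "integrable M (\<lambda>x. (?g x)\<^sup>2)"
    by (rule Bochner_Integration.integrable_bound[of M "\<lambda>x. 2 * c\<^sup>2 * (p x + q x)"])
      (use int g_le nn in \<open>auto intro!: AE_I2\<close>)
  have "(\<integral>x. (?g x)\<^sup>2 \<partial>M) \<le> (\<integral>x. 2 * c\<^sup>2 * (p x + q x) \<partial>M)"
    by (rule integral_mono) (use int_g int g_le in auto)
  also have "\<dots> = 4 * c\<^sup>2" using int by simp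
  finally have "(\<integral>x. ?f x * ?g x \<partial>M)\<^sup>2 \<le> 4 * c\<^sup>2 * (\<integral>x. (?f x)\<^sup>2 \<partial>M)"
    using int_diff int_g prod_int \<open>0 < c\<close>
    by (intro square_integral_mult_le) (simp_all add: fg power2_commute)
  moreover have "(\<integral>x. ?f x * ?g x \<partial>M) = (\<integral>x. u x \<partial>P) - (\<integral>x. u x \<partial>Q)"
  proof -
    have "(\<integral>x. u x \<partial>density M (\<lambda>x. ennreal (p x))) = (\<integral>x. p x * u x \<partial>M)"
      "(\<integral>x. u x \<partial>density M (\<lambda>x. ennreal (q x))) = (\<integral>x. q x * u x \<partial>M)"
      by (subst integral_density; auto simp: nn)+
    then show ?thesis using prod_int by (simp add: fg dP dQ)
  qed
  ultimately show "((\<integral>x. u x \<partial>P) - (\<integral>x. u x \<partial>Q))\<^sup>2 \<le> 8 * c\<^sup>2 * hellinger2 P Q"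
    by (simp add: hell power2_commute)
qed

section \<open>Value decomposition\<close>

lemma
  fixes f :: "'a \<Rightarrow> real"
  assumes P: "P \<in> space (prob_algebra N)" and f: "f \<in> borel_measurable N"
    and bd: "\<And>y. y \<in> space N \<Longrightarrow> \<bar>f y\<bar> \<le> c"
  shows integrable_bounded_prob_algebra: "integrable P f"
    and abs_integral_le_prob_algebra: "\<bar>\<integral>y. f y \<partial>P\<bar> \<le> c"
proof -
  have sets: "sets P = sets N" and prob: "prob_space P" using P by (auto simp: space_prob_algebra)
  interpret prob_space P by (rule prob)
  have sp: "space P = space N" by (rule sets_eq_imp_space_eq[OF sets])
  show int: "integrable P f"
    using f bd by (intro integrable_const_bound[where B = c])
      (auto simp: sp measurable_cong_sets[OF sets refl])
  have "\<bar>\<integral>y. f y \<partial>P\<bar> \<le> (\<integral>y. \<bar>f y\<bar> \<partial>P)" by (rule integral_abs_bound)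
  also have "\<dots> \<le> (\<integral>y. c \<partial>P)" using int bd by (intro integral_mono) (auto simp: sp)
  finally show "\<bar>\<integral>y. f y \<partial>P\<bar> \<le> c" by (simp add: prob_space)
qed

text \<open>Averaging over a probability measure preserves the bound \<open>c\<close>. Iterated
  averages therefore stay bounded and integrable, and \<open>integral_bind\<close> applies.\<close>

lemma
  fixes f :: "'a \<Rightarrow> real"
  assumes K: "K \<in> M \<rightarrow>\<^sub>M prob_algebra N" and f: "f \<in> borel_measurable N"
    and bd: "\<And>y. y \<in> space N \<Longrightarrow> \<bar>f y\<bar> \<le> c"
  shows borel_measurable_kernel_integral: "(\<lambda>x. \<integral>y. f y \<partial>K x) \<in> borel_measurable M"
    and abs_kernel_integral_le: "x \<in> space M \<Longrightarrow> \<bar>\<integral>y. f y \<partial>K x\<bar> \<le> c"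
    and integrable_kernel_integral:
      "P \<in> space (prob_algebra M) \<Longrightarrow> integrable P (\<lambda>x. \<integral>y. f y \<partial>K x)"
    and integral_bind_kernel: "P \<in> space (prob_algebra M) \<Longrightarrow>
      (\<integral>y. f y \<partial>(P \<bind> K)) = (\<integral>x. \<integral>y. f y \<partial>K x \<partial>P)"
proof -
  show meas: "(\<lambda>x. \<integral>y. f y \<partial>K x) \<in> borel_measurable M"
    by (rule measurable_compose[OF measurable_prob_algebraD[OF K]
          integral_measurable_subprob_algebra[OF f]])
  show le: "\<bar>\<integral>y. f y \<partial>K x\<bar> \<le> c" if "x \<in> space M" for x
    by (rule abs_integral_le_prob_algebra[OF measurable_space[OF K that] f bd])
  assume P: "P \<in> space (prob_algebra M)"
  show "integrable P (\<lambda>x. \<integral>y. f y \<partial>K x)"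
    by (rule integrable_bounded_prob_algebra[OF P meas le])
  have sets: "sets P = sets M" and prob: "prob_space P" using P by (auto simp: space_prob_algebra)
  interpret prob_space P by (rule prob)
  have sp: "space P = space M" by (rule sets_eq_imp_space_eq[OF sets])
  show "(\<integral>y. f y \<partial>(P \<bind> K)) = (\<integral>x. \<integral>y. f y \<partial>K x \<partial>P)"
  proof (rule integral_bind[where K = N and B = c and B' = 1])
    show "K \<in> P \<rightarrow>\<^sub>M subprob_algebra N"
      using measurable_prob_algebraD[OF K] by (simp add: measurable_cong_sets[OF sets refl])
    show "finite_measure P" by unfold_locales
    show "AE x in P. emeasure (K x) (space (K x)) \<le> ennreal 1"
    proof (rule AE_I2)
      fix x assume "x \<in> space P"
      then have "prob_space (K x)"
        using measurable_space[OF K] by (simp add: sp space_prob_algebra)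
      then show "emeasure (K x) (space (K x)) \<le> ennreal 1"
        by (simp add: prob_space.emeasure_space_1)
    qed
  qed (use f bd in auto)
qed

lemma bind_assoc_kernel:
  assumes "P \<in> space (prob_algebra M)" "K \<in> M \<rightarrow>\<^sub>M prob_algebra N" "L \<in> N \<rightarrow>\<^sub>M prob_algebra R"
  shows "P \<bind> K \<bind> L = P \<bind> (\<lambda>x. K x \<bind> L)"
proof (rule bind_assoc)
  have sets: "sets P = sets M" using assms(1) by (simp add: space_prob_algebra)
  show "K \<in> P \<rightarrow>\<^sub>M subprob_algebra N"
    unfolding measurable_cong_sets[OF sets refl] by (rule measurable_prob_algebraD[OF assms(2)])
qed (rule measurable_prob_algebraD[OF assms(3)])

lemma bind_in_space_prob_algebra:
  assumes "P \<in> space (prob_algebra M)" "K \<in> M \<rightarrow>\<^sub>M prob_algebra N"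
  shows "P \<bind> K \<in> space (prob_algebra N)"
  using assms by (simp add: space_prob_algebra[of N] prob_space_bind' sets_bind')

section \<open>State laws, value functions and Bellman residuals under a fixed pair of
  policies\<close>

context
  fixes G :: "('s, 'a, 'b, 'f) game" and \<pi> :: "('s, 'a) policy" and \<nu> :: "('s, 'b) policy"
  assumes G: "markov_game G" and \<pi>: "\<pi> \<in> max_policies G" and \<nu>: "\<nu> \<in> min_policies G"
begin

lemma trans_kernel:
  "f \<in> models G \<Longrightarrow> h \<in> {1..horizon G} \<Longrightarrow> trans G f h \<in> data_space G \<rightarrow>\<^sub>M prob_algebra (states G)"
  using G by (auto simp: markov_game_def)

lemma reward_bounds:
  assumes "h \<in> {1..horizon G}"
  shows "reward G h \<in> borel_measurable (data_space G)"
    and "x \<in> space (data_space G) \<Longrightarrow> \<bar>reward G h x\<bar> \<le> 1"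
  using G assms by (auto simp: markov_game_def)

lemma play_kernel:
  assumes "h \<in> {1..horizon G}"
  shows "play G \<pi> \<nu> h \<in> states G \<rightarrow>\<^sub>M prob_algebra (data_space G)"
proof -
  have [measurable]: "\<pi> h \<in> states G \<rightarrow>\<^sub>M prob_algebra (acts_max G)"
    "\<nu> h \<in> states G \<rightarrow>\<^sub>M prob_algebra (acts_min G)"
    using \<pi> \<nu> assms by (auto simp: max_policies_def min_policies_def)
  have "(\<lambda>s. distr (\<pi> h s \<Otimes>\<^sub>M \<nu> h s) (data_space G) ((\<lambda>s (a, b). (s, a, b)) s))
      \<in> states G \<rightarrow>\<^sub>M prob_algebra (data_space G)"
    unfolding data_space_def
    by (rule measurable_distr_prob_space2[where M = "acts_max G \<Otimes>\<^sub>M acts_min G"]) measurable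
  then show ?thesis by (simp add: play_def[abs_def])
qed

lemma play_trans_kernel:
  assumes "f \<in> models G" "h \<in> {1..horizon G}"
  shows "(\<lambda>s. play G \<pi> \<nu> h s \<bind> trans G f h) \<in> states G \<rightarrow>\<^sub>M prob_algebra (states G)"
  by (rule measurable_bind_prob_space[OF play_kernel trans_kernel]) (use assms in auto)

text \<open>The law of the state after \<open>n\<close> moves uses the transitions of steps
  \<open>h\<close> to \<open>h + n - 1\<close> only, so \<open>h + n\<close> may exceed the horizon
  by one.\<close>

lemma state_law_kernel:
  assumes f: "f \<in> models G" and "1 \<le> h" "h + n \<le> horizon G + 1"
  shows "(\<lambda>s. state_law G f \<pi> \<nu> h s n) \<in> states G \<rightarrow>\<^sub>M prob_algebra (states G)"
  using assms(3)
proof (induction n)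
  case (Suc n)
  then show ?case using assms(2)
    by (auto intro!: measurable_bind_prob_space[OF _ play_trans_kernel] f)
qed simp

lemma data_law_kernel:
  assumes f: "f \<in> models G" and "1 \<le> h" "h \<le> k" "k \<le> horizon G"
  shows "(\<lambda>s. data_law G f \<pi> \<nu> h s k) \<in> states G \<rightarrow>\<^sub>M prob_algebra (data_space G)"
  unfolding data_law_def
  by (rule measurable_bind_prob_space[OF state_law_kernel play_kernel]) (use assms in auto)

text \<open>\<open>state_law\<close> appends transitions at the end, whereas the Bellman equation
  splits off the first one. Associativity of \<open>bind\<close> converts one form into the
  other.\<close>

lemma state_law_Suc_first_step:
  assumes f: "f \<in> models G" and s: "s \<in> space (states G)"
    and "1 \<le> h" "h + Suc n \<le> horizon G + 1"
  shows "state_law G f \<pi> \<nu> h s (Suc n) =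
    play G \<pi> \<nu> h s \<bind> trans G f h \<bind> (\<lambda>s'. state_law G f \<pi> \<nu> (h + 1) s' n)"
  using assms(4)
proof (induction n)
  case 0
  then have h: "h \<in> {1..horizon G}" using assms(3) by simp
  have "state_law G f \<pi> \<nu> h s (Suc 0) = play G \<pi> \<nu> h s \<bind> trans G f h"
    using bind_return[OF measurable_prob_algebraD[OF play_trans_kernel[OF f h]] s] by simp
  moreover have "play G \<pi> \<nu> h s \<bind> trans G f h \<in> space (prob_algebra (states G))"
    by (rule measurable_space[OF play_trans_kernel[OF f h] s])
  ultimately show ?case by (simp add: bind_return'' space_prob_algebra)
next
  case (Suc n)
  then have h: "h \<in> {1..horizon G}" "h + Suc n \<in> {1..horizon G}" using assms(3) by auto
  have "state_law G f \<pi> \<nu> h s (Suc (Suc n)) =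
      play G \<pi> \<nu> h s \<bind> trans G f h \<bind> (\<lambda>s'. state_law G f \<pi> \<nu> (h + 1) s' n)
        \<bind> (\<lambda>s'. play G \<pi> \<nu> (h + Suc n) s' \<bind> trans G f (h + Suc n))"
    using Suc by (simp del: state_law.simps add: state_law.simps(2)[of _ _ _ _ _ _ "Suc n"])
  also have "\<dots> = play G \<pi> \<nu> h s \<bind> trans G f h \<bind> (\<lambda>s'. state_law G f \<pi> \<nu> (h + 1) s' n
        \<bind> (\<lambda>s'. play G \<pi> \<nu> (h + Suc n) s' \<bind> trans G f (h + Suc n)))"
    by (rule bind_assoc_kernel[OF measurable_space[OF play_trans_kernel[OF f h(1)] s]
          state_law_kernel[OF f] play_trans_kernel[OF f h(2)]])
      (use Suc assms(3) in auto)
  finally show ?case by simp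
qed

lemma data_law_same_step:
  assumes "s \<in> space (states G)" "h \<in> {1..horizon G}"
  shows "data_law G f \<pi> \<nu> h s h = play G \<pi> \<nu> h s"
  using bind_return[OF measurable_prob_algebraD[OF play_kernel[OF assms(2)]] assms(1)]
  by (simp add: data_law_def)

lemma data_law_first_step:
  assumes f: "f \<in> models G" and s: "s \<in> space (states G)" and hk: "1 \<le> h" "h < k" "k \<le> horizon G"
  shows "data_law G f \<pi> \<nu> h s k =
    play G \<pi> \<nu> h s \<bind> trans G f h \<bind> (\<lambda>s'. data_law G f \<pi> \<nu> (h + 1) s' k)"
proof -
  obtain n where k: "k = h + Suc n" using hk less_imp_Suc_add by auto
  have h: "h \<in> {1..horizon G}" using hk by simp
  have "data_law G f \<pi> \<nu> h s k = state_law G f \<pi> \<nu> h s (Suc n) \<bind> play G \<pi> \<nu> k"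
    by (simp add: data_law_def k)
  also have "\<dots> = play G \<pi> \<nu> h s \<bind> trans G f h \<bind> (\<lambda>s'. state_law G f \<pi> \<nu> (h + 1) s' n) \<bind> play G \<pi> \<nu> k"
    by (subst state_law_Suc_first_step[OF f s]) (use hk k in auto)
  also have "\<dots> = play G \<pi> \<nu> h s \<bind> trans G f h \<bind> (\<lambda>s'. state_law G f \<pi> \<nu> (h + 1) s' n \<bind> play G \<pi> \<nu> k)"
    by (rule bind_assoc_kernel[OF measurable_space[OF play_trans_kernel[OF f h] s]
          state_law_kernel[OF f] play_kernel])
      (use hk k in auto)
  finally show ?thesis by (simp add: data_law_def k)
qed

text \<open>The value is a sum of at most \<open>horizon G\<close> expected rewards of size at most
  1; this crude bound serves integrability. The step \<open>h\<close> has no upper limit, so that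
  \<open>h + 1\<close> is covered at the last step, where the sum is empty.\<close>

lemma
  assumes f: "f \<in> models G" and h: "1 \<le> h"
  shows borel_measurable_V_step: "V_step G f \<pi> \<nu> h \<in> borel_measurable (states G)"
    and abs_V_step_le: "s \<in> space (states G) \<Longrightarrow> \<bar>V_step G f \<pi> \<nu> h s\<bar> \<le> real (horizon G)"
proof -
  show "V_step G f \<pi> \<nu> h \<in> borel_measurable (states G)"
    unfolding V_step_def using h
    by (intro borel_measurable_sum borel_measurable_kernel_integral[OF data_law_kernel[OF f] reward_bounds])
      auto
  assume s: "s \<in> space (states G)"
  have "\<bar>V_step G f \<pi> \<nu> h s\<bar> \<le> (\<Sum>k\<in>{h..horizon G}. \<bar>LINT x|data_law G f \<pi> \<nu> h s k. reward G k x\<bar>)"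
    unfolding V_step_def by (rule sum_abs)
  also have "\<dots> \<le> (\<Sum>k\<in>{h..horizon G}. 1)"
    using h by (intro sum_mono abs_kernel_integral_le[OF data_law_kernel[OF f] reward_bounds] s) auto
  also have "\<dots> \<le> real (horizon G)" using h by simp
  finally show "\<bar>V_step G f \<pi> \<nu> h s\<bar> \<le> real (horizon G)" .
qed

text \<open>The Bellman equation has to be derived, since \<open>V_step\<close> is defined as a sum
  of expected rewards rather than by backward recursion. The reward of step \<open>h\<close> comes
  from \<open>play\<close>; every later one is averaged over the state after the first
  transition.\<close>

lemma V_step_eq_integral_Q_step:
  assumes f: "f \<in> models G" and s: "s \<in> space (states G)" and h: "h \<in> {1..horizon G}"
  shows "V_step G f \<pi> \<nu> h s = (LINT x|play G \<pi> \<nu> h s. Q_step G f \<pi> \<nu> h x)"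
proof -
  let ?P = "play G \<pi> \<nu> h s"
  have P: "?P \<in> space (prob_algebra (data_space G))" by (rule measurable_space[OF play_kernel[OF h] s])
  have PT: "?P \<bind> trans G f h \<in> space (prob_algebra (states G))"
    by (rule bind_in_space_prob_algebra[OF P trans_kernel[OF f h]])
  have V: "V_step G f \<pi> \<nu> (h + 1) \<in> borel_measurable (states G)"
    "\<And>s. s \<in> space (states G) \<Longrightarrow> \<bar>V_step G f \<pi> \<nu> (h + 1) s\<bar> \<le> real (horizon G)"
    using borel_measurable_V_step[OF f] abs_V_step_le[OF f] by auto
  have later: "(LINT x|data_law G f \<pi> \<nu> h s k. reward G k x) =
      (LINT s'|(?P \<bind> trans G f h). LINT x|data_law G f \<pi> \<nu> (h + 1) s' k. reward G k x)"
    if k: "k \<in> {h+1..horizon G}" for k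
  proof -
    have "data_law G f \<pi> \<nu> h s k = ?P \<bind> trans G f h \<bind> (\<lambda>s'. data_law G f \<pi> \<nu> (h + 1) s' k)"
      by (rule data_law_first_step[OF f s]) (use h k in auto)
    then show ?thesis
      using integral_bind_kernel[OF data_law_kernel[OF f] reward_bounds PT, of "h + 1" k k] h k by simp
  qed
  have "(LINT x|?P. Q_step G f \<pi> \<nu> h x) =
      (LINT x|?P. reward G h x) + (LINT x|?P. LINT s'|trans G f h x. V_step G f \<pi> \<nu> (h + 1) s')"
    unfolding Q_step_def
    by (intro Bochner_Integration.integral_add
        integrable_bounded_prob_algebra[OF P reward_bounds[OF h]]
        integrable_kernel_integral[OF trans_kernel[OF f h] V P])
  also have "(LINT x|?P. LINT s'|trans G f h x. V_step G f \<pi> \<nu> (h + 1) s') =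
      (LINT s'|(?P \<bind> trans G f h). V_step G f \<pi> \<nu> (h + 1) s')"
    by (rule integral_bind_kernel[OF trans_kernel[OF f h] V P, symmetric])
  also have "\<dots> = (\<Sum>k\<in>{h+1..horizon G}.
      LINT s'|(?P \<bind> trans G f h). LINT x|data_law G f \<pi> \<nu> (h + 1) s' k. reward G k x)"
    unfolding V_step_def
    by (intro Bochner_Integration.integral_sum
        integrable_kernel_integral[OF data_law_kernel[OF f] reward_bounds PT]) auto
  also have "\<dots> = (\<Sum>k\<in>{h+1..horizon G}. LINT x|data_law G f \<pi> \<nu> h s k. reward G k x)"
    by (intro sum.cong refl later[symmetric])
  also have "(LINT x|?P. reward G h x) = (LINT x|data_law G f \<pi> \<nu> h s h. reward G h x)"
    by (simp add: data_law_same_step[OF s h])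
  finally show ?thesis
    using h by (simp add: V_step_def sum.atLeast_Suc_atMost[of h "horizon G"])
qed

lemma true_law_in_prob_algebra:
  assumes "h \<in> {1..horizon G}"
  shows "true_law G \<pi> \<nu> h \<in> space (prob_algebra (data_space G))"
  unfolding true_law_def
  by (rule measurable_space[OF data_law_kernel]) (use assms G in \<open>auto simp: markov_game_def\<close>)

text \<open>A telescoping sum. The residual at step \<open>h\<close> is the expected model value at
  \<open>h\<close>, minus that at \<open>h + 1\<close>, minus the expected reward, with all states
  drawn from the truth. The first term of the telescope is the value under \<open>\<rho>\<close>,
  the one past the horizon is 0, and the rewards add up to the true value.\<close>

lemma value_difference_eq_sum_bellman_residual:
  assumes \<rho>: "\<rho> \<in> models G"
  shows "game_value G \<rho> \<pi> \<nu> - game_value G (truth G) \<pi> \<nu> =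
    (\<Sum>h = 1..horizon G. bellman_residual G \<rho> \<pi> \<nu> h)"
proof -
  let ?f = "truth G" and ?s = "init G"
  have f: "?f \<in> models G" and s: "?s \<in> space (states G)" using G by (auto simp: markov_game_def)
  define d where "d h = state_law G ?f \<pi> \<nu> 1 ?s (h - 1)" for h
  have d: "d h \<in> space (prob_algebra (states G))" if "h \<in> {1..horizon G + 1}" for h
    unfolding d_def by (rule measurable_space[OF state_law_kernel[OF f] s]) (use that in auto)
  \<comment> \<open>Two models meet here: the states follow the truth, the value function belongs to
    \<open>\<rho>\<close>.\<close>
  define C where "C h = (LINT s|d h. V_step G \<rho> \<pi> \<nu> h s)" for h
  define r where "r h = (LINT x|true_law G \<pi> \<nu> h. reward G h x)" for h
  have step: "bellman_residual G \<rho> \<pi> \<nu> h = C h - C (Suc h) - r h" if h: "h \<in> {1..horizon G}" for h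
  proof -
    let ?L = "true_law G \<pi> \<nu> h"
    note L = true_law_in_prob_algebra[OF h]
    have L_eq: "?L = d h \<bind> play G \<pi> \<nu> h" by (simp add: true_law_def data_law_def d_def)
    have dh: "d h \<in> space (prob_algebra (states G))" using d h by auto
    have V: "V_step G \<rho> \<pi> \<nu> (h + 1) \<in> borel_measurable (states G)"
      "\<And>s. s \<in> space (states G) \<Longrightarrow> \<bar>V_step G \<rho> \<pi> \<nu> (h + 1) s\<bar> \<le> real (horizon G)"
      using borel_measurable_V_step[OF \<rho>] abs_V_step_le[OF \<rho>] by auto
    note intV = borel_measurable_kernel_integral[OF trans_kernel[OF _ h] V]
    have Q: "Q_step G \<rho> \<pi> \<nu> h \<in> borel_measurable (data_space G)"
      unfolding Q_step_def using reward_bounds(1)[OF h] intV[OF \<rho>] by (rule borel_measurable_add)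
    have Qb: "\<bar>Q_step G \<rho> \<pi> \<nu> h x\<bar> \<le> 1 + real (horizon G)" if "x \<in> space (data_space G)" for x
      unfolding Q_step_def
      by (intro order_trans[OF abs_triangle_ineq] add_mono reward_bounds(2)[OF h that]
          abs_kernel_integral_le[OF trans_kernel[OF \<rho> h] V that])
    have "C h = (LINT s|d h. LINT x|play G \<pi> \<nu> h s. Q_step G \<rho> \<pi> \<nu> h x)"
      unfolding C_def
    proof (rule Bochner_Integration.integral_cong[OF refl])
      fix s assume "s \<in> space (d h)"
      moreover have "space (d h) = space (states G)"
        using dh by (intro sets_eq_imp_space_eq) (simp add: space_prob_algebra)
      ultimately show "V_step G \<rho> \<pi> \<nu> h s = (LINT x|play G \<pi> \<nu> h s. Q_step G \<rho> \<pi> \<nu> h x)"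
        by (intro V_step_eq_integral_Q_step[OF \<rho> _ h]) simp
    qed
    also have "\<dots> = (LINT x|?L. Q_step G \<rho> \<pi> \<nu> h x)"
      unfolding L_eq by (rule integral_bind_kernel[OF play_kernel[OF h] Q Qb dh, symmetric])
    finally have C_h: "C h = (LINT x|?L. Q_step G \<rho> \<pi> \<nu> h x)" .
    \<comment> \<open>The recursion of \<open>state_law\<close> runs on \<open>h - 1\<close>, so
      \<open>h\<close> is exposed as a successor to unfold one transition.\<close>
    obtain n where n: "h = Suc n" using h by (cases h) auto
    have "d (Suc h) = d h \<bind> (\<lambda>s. play G \<pi> \<nu> h s \<bind> trans G ?f h)" by (simp add: d_def n)
    also have "\<dots> = ?L \<bind> trans G ?f h"
      unfolding L_eq by (rule bind_assoc_kernel[OF dh play_kernel[OF h] trans_kernel[OF f h], symmetric])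
    finally have "C (Suc h) = (LINT x|?L. LINT s'|trans G ?f h x. V_step G \<rho> \<pi> \<nu> (h + 1) s')"
      unfolding C_def using integral_bind_kernel[OF trans_kernel[OF f h] V L] by simp
    moreover have "bellman_residual G \<rho> \<pi> \<nu> h = (LINT x|?L. Q_step G \<rho> \<pi> \<nu> h x
        - (reward G h x + (LINT s'|trans G ?f h x. V_step G \<rho> \<pi> \<nu> (h + 1) s')))"
      unfolding bellman_residual_def
    proof (rule Bochner_Integration.integral_cong[OF refl])
      fix x assume "x \<in> space ?L"
      moreover have "space ?L = space (data_space G)"
        using L by (intro sets_eq_imp_space_eq) (simp add: space_prob_algebra)
      ultimately have T: "trans G ?f h x \<in> space (prob_algebra (states G))"
        by (intro measurable_space[OF trans_kernel[OF f h]]) simp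
      then interpret prob_space "trans G ?f h x" by (simp add: space_prob_algebra)
      show "Q_step G \<rho> \<pi> \<nu> h x - (LINT s'|trans G ?f h x. reward G h x + V_step G \<rho> \<pi> \<nu> (h + 1) s') =
          Q_step G \<rho> \<pi> \<nu> h x - (reward G h x + (LINT s'|trans G ?f h x. V_step G \<rho> \<pi> \<nu> (h + 1) s'))"
        using integrable_bounded_prob_algebra[OF T V] by (simp add: prob_space)
    qed
    moreover have "integrable ?L (Q_step G \<rho> \<pi> \<nu> h)" "integrable ?L (reward G h)"
      "integrable ?L (\<lambda>x. LINT s'|trans G ?f h x. V_step G \<rho> \<pi> \<nu> (h + 1) s')"
      by (rule integrable_bounded_prob_algebra[OF L Q Qb]
          integrable_bounded_prob_algebra[OF L reward_bounds[OF h]]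
          integrable_kernel_integral[OF trans_kernel[OF f h] V L]; assumption)+
    ultimately show ?thesis by (simp add: C_h r_def)
  qed
  have "(\<Sum>h = 1..horizon G. bellman_residual G \<rho> \<pi> \<nu> h) = (\<Sum>h = 1..horizon G. C h - C (Suc h) - r h)"
    by (rule sum.cong[OF refl step])
  also have "\<dots> = - (\<Sum>h = 1..horizon G. C (Suc h) - C h) - (\<Sum>h = 1..horizon G. r h)"
    by (simp add: sum_subtractf)
  also have "(\<Sum>h = 1..horizon G. C (Suc h) - C h) = C (Suc (horizon G)) - C 1"
    by (rule sum_Suc_diff) simp
  also have "C 1 = game_value G \<rho> \<pi> \<nu>"
    using borel_measurable_V_step[OF \<rho>] s by (simp add: C_def d_def game_value_def integral_return)
  also have "C (Suc (horizon G)) = 0" by (simp add: C_def V_step_def)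
  also have "(\<Sum>h = 1..horizon G. r h) = game_value G ?f \<pi> \<nu>"
    by (simp add: r_def game_value_def V_step_def true_law_def)
  finally show ?thesis by simp
qed

end

section \<open>Witness rank and eluder coefficient\<close>

text \<open>The integrand depends on \<open>x\<close> as well. Pushing \<open>K x\<close> forward
  along \<open>Pair x\<close> moves this dependence into the kernel and leaves the fixed integrand
  \<open>u\<close> on the product space.\<close>

lemma borel_measurable_kernel_integral2:
  fixes u :: "'a \<times> 'b \<Rightarrow> real"
  assumes u: "u \<in> borel_measurable (M \<Otimes>\<^sub>M N)" and K: "K \<in> M \<rightarrow>\<^sub>M prob_algebra N"
  shows "(\<lambda>x. \<integral>y. u (x, y) \<partial>K x) \<in> borel_measurable M"
proof -
  have "(\<lambda>x. distr (K x) (M \<Otimes>\<^sub>M N) (Pair x)) \<in> M \<rightarrow>\<^sub>M subprob_algebra (M \<Otimes>\<^sub>M N)"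
    by (rule measurable_distr2[OF _ measurable_prob_algebraD[OF K]]) simp
  then have "(\<lambda>x. \<integral>z. u z \<partial>distr (K x) (M \<Otimes>\<^sub>M N) (Pair x)) \<in> borel_measurable M"
    by (rule measurable_compose[OF _ integral_measurable_subprob_algebra[OF u]])
  moreover have "(\<integral>z. u z \<partial>distr (K x) (M \<Otimes>\<^sub>M N) (Pair x)) = (\<integral>y. u (x, y) \<partial>K x)"
    if x: "x \<in> space M" for x
  proof (rule integral_distr[OF _ u])
    have sets: "sets (K x) = sets N"
      using measurable_space[OF K x] by (simp add: space_prob_algebra)
    show "Pair x \<in> K x \<rightarrow>\<^sub>M M \<Otimes>\<^sub>M N"
      unfolding measurable_cong_sets[OF sets refl] by (rule measurable_Pair1'[OF x])
  qed
  ultimately show ?thesis by (simp cong: measurable_cong)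
qed

text \<open>The Hellinger bound holds at each \<open>x\<close>, and Jensen's inequality carries the
  square inside the integral over \<open>L\<close>. The right-hand side uses
  \<open>nn_integral\<close>, which is monotone for arbitrary functions, so the pointwise bound
  passes to it directly.\<close>

lemma square_integral_le_hellinger2_kernels:
  fixes u :: "'a \<times> 'b \<Rightarrow> real"
  assumes L: "L \<in> space (prob_algebra M)"
    and K: "K \<in> M \<rightarrow>\<^sub>M prob_algebra N" and K': "K' \<in> M \<rightarrow>\<^sub>M prob_algebra N"
    and u: "u \<in> borel_measurable (M \<Otimes>\<^sub>M N)"
    and bd: "\<And>z. z \<in> space (M \<Otimes>\<^sub>M N) \<Longrightarrow> \<bar>u z\<bar> \<le> c" and c: "0 < c"
  shows "(\<integral>x. (\<integral>y. u (x, y) \<partial>K x) - (\<integral>y. u (x, y) \<partial>K' x) \<partial>L)\<^sup>2 \<le>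
    8 * c\<^sup>2 * enn2real (\<integral>\<^sup>+x. ennreal (hellinger2 (K x) (K' x)) \<partial>L)"
proof -
  have sets: "sets L = sets M" and prob: "prob_space L" using L by (auto simp: space_prob_algebra)
  interpret prob_space L by (rule prob)
  have sp: "space L = space M" by (rule sets_eq_imp_space_eq[OF sets])
  define \<phi> where "\<phi> x = (\<integral>y. u (x, y) \<partial>K x) - (\<integral>y. u (x, y) \<partial>K' x)" for x
  have \<phi>M: "\<phi> \<in> borel_measurable M"
    unfolding \<phi>_def[abs_def]
    by (intro borel_measurable_diff borel_measurable_kernel_integral2[OF u] K K')
  have kernels: "K x \<in> space (prob_algebra N)" "K' x \<in> space (prob_algebra N)" if "x \<in> space L" for x
    using measurable_space[OF K] measurable_space[OF K'] that by (simp_all add: sp)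
  have pointwise: "(\<phi> x)\<^sup>2 \<le> 8 * c\<^sup>2 * hellinger2 (K x) (K' x)" "hellinger2 (K x) (K' x) \<le> 1"
    if x: "x \<in> space L" for x
  proof -
    have P: "prob_space (K x)" "prob_space (K' x)" "sets (K x) = sets N" "sets (K' x) = sets (K x)"
      using kernels[OF x] by (auto simp: space_prob_algebra)
    then show "hellinger2 (K x) (K' x) \<le> 1" by (intro hellinger2_le_1)
    have spK: "space (K x) = space N" by (rule sets_eq_imp_space_eq[OF P(3)])
    show "(\<phi> x)\<^sup>2 \<le> 8 * c\<^sup>2 * hellinger2 (K x) (K' x)"
      unfolding \<phi>_def
    proof (rule square_diff_integrals_le_hellinger2[OF P(1,2,4)])
      show "(\<lambda>y. u (x, y)) \<in> borel_measurable (K x)"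
        unfolding measurable_cong_sets[OF P(3) refl]
        using measurable_compose[OF measurable_Pair1' u, of x] x by (simp add: sp)
      show "\<bar>u (x, y)\<bar> \<le> c" if "y \<in> space (K x)" for y
        using bd that x by (simp add: space_pair_measure spK sp)
    qed (rule c)
  qed
  have \<phi>2: "(\<phi> x)\<^sup>2 \<le> 8 * c\<^sup>2" if "x \<in> space M" for x
  proof -
    have "8 * c\<^sup>2 * hellinger2 (K x) (K' x) \<le> 8 * c\<^sup>2 * 1"
      using pointwise(2)[of x] that by (intro mult_left_mono) (auto simp: sp)
    then show ?thesis using pointwise(1)[of x] that by (simp add: sp)
  qed
  have \<phi>b: "\<bar>\<phi> x\<bar> \<le> sqrt (8 * c\<^sup>2)" if "x \<in> space M" for x
    using real_sqrt_le_mono[OF \<phi>2[OF that]] by simp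
  have int: "integrable L \<phi>" by (rule integrable_bounded_prob_algebra[OF L \<phi>M \<phi>b])
  have int2: "integrable L (\<lambda>x. (\<phi> x)\<^sup>2)"
    by (rule integrable_bounded_prob_algebra[OF L _, where c = "8 * c\<^sup>2"]) (use \<phi>M \<phi>2 in auto)
  have jensen: "(\<integral>x. \<phi> x \<partial>L)\<^sup>2 \<le> (\<integral>x. (\<phi> x)\<^sup>2 \<partial>L)"
    using square_integral_mult_le[OF int2, of "\<lambda>_. 1" 1] int by (simp add: prob_space)
  have "(\<integral>x. (\<phi> x)\<^sup>2 \<partial>L) / (8 * c\<^sup>2) = (\<integral>x. (\<phi> x)\<^sup>2 / (8 * c\<^sup>2) \<partial>L)" by simp
  also have "\<dots> = enn2real (\<integral>\<^sup>+x. ennreal ((\<phi> x)\<^sup>2 / (8 * c\<^sup>2)) \<partial>L)"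
    by (rule integral_eq_nn_integral) (use int2 in auto)
  also have "\<dots> \<le> enn2real (\<integral>\<^sup>+x. ennreal (hellinger2 (K x) (K' x)) \<partial>L)"
  \<comment> \<open>\<open>enn2real\<close> sends infinity to 0, so it is monotone only below a
    finite bound; here \<open>hellinger2\<close> is at most 1 and \<open>L\<close> has mass
    1.\<close>
  proof (rule enn2real_mono)
    show "(\<integral>\<^sup>+x. ennreal ((\<phi> x)\<^sup>2 / (8 * c\<^sup>2)) \<partial>L) \<le> (\<integral>\<^sup>+x. ennreal (hellinger2 (K x) (K' x)) \<partial>L)"
      using pointwise(1) c by (intro nn_integral_mono ennreal_leI) (simp add: divide_le_eq mult.commute)
    have "(\<integral>\<^sup>+x. ennreal (hellinger2 (K x) (K' x)) \<partial>L) \<le> (\<integral>\<^sup>+x. 1 \<partial>L)"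
      using pointwise(2) by (intro nn_integral_mono) (simp add: ennreal_le_1)
    then show "(\<integral>\<^sup>+x. ennreal (hellinger2 (K x) (K' x)) \<partial>L) < top"
      by (simp add: emeasure_space_1 order.strict_trans1[OF _ ennreal_one_less_top])
  qed
  finally have "(\<integral>x. (\<phi> x)\<^sup>2 \<partial>L) \<le> 8 * c\<^sup>2 * enn2real (\<integral>\<^sup>+x. ennreal (hellinger2 (K x) (K' x)) \<partial>L)"
    using c by (simp add: divide_le_eq mult.commute)
  with jensen show ?thesis unfolding \<phi>_def by linarith
qed

text \<open>Discriminators take values in \<open>[0, H]\<close>, so the kernel bound applies with
  \<open>c = H\<close>, uniformly over the class. Its factor 8 reappears in the eluder
  coefficient.\<close>

lemma model_misfit_le_sqrt_expected_loss:
  assumes G: "markov_game G" and \<pi>: "\<pi> \<in> max_policies G" and \<nu>: "\<nu> \<in> min_policies G"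
    and U: "discriminator_class G U" and \<rho>: "\<rho> \<in> models G" and h: "h \<in> {1..horizon G}"
  shows "model_misfit G U \<pi> \<nu> \<rho> h \<le>
    sqrt (8 * (real (horizon G))\<^sup>2 * expected_loss G (hellinger_loss G) \<pi> \<nu> h \<rho>)"
  unfolding model_misfit_def
proof (rule cSUP_least)
  show "U \<noteq> {}" using U by (simp add: discriminator_class_def)
  fix u assume "u \<in> U"
  then have u: "u \<in> borel_measurable (data_space G \<Otimes>\<^sub>M states G)"
    "\<And>z. z \<in> space (data_space G \<Otimes>\<^sub>M states G) \<Longrightarrow> \<bar>u z\<bar> \<le> real (horizon G)"
    using U by (auto simp: discriminator_class_def)
  have f: "truth G \<in> models G" and H: "0 < real (horizon G)" using G by (auto simp: markov_game_def)
  have "(LINT x|true_law G \<pi> \<nu> h. (LINT s'|trans G \<rho> h x. u (x, s')) - (LINT s'|trans G (truth G) h x. u (x, s')))\<^sup>2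
      \<le> 8 * (real (horizon G))\<^sup>2 * expected_loss G (hellinger_loss G) \<pi> \<nu> h \<rho>"
    unfolding expected_loss_def hellinger_loss_def
    by (rule square_integral_le_hellinger2_kernels[OF true_law_in_prob_algebra[OF G \<pi> \<nu> h]
          trans_kernel[OF G \<pi> \<nu> \<rho> h] trans_kernel[OF G \<pi> \<nu> f h] u H])
  then show "\<bar>LINT x|true_law G \<pi> \<nu> h. (LINT s'|trans G \<rho> h x. u (x, s')) - (LINT s'|trans G (truth G) h x. u (x, s'))\<bar>
      \<le> sqrt (8 * (real (horizon G))\<^sup>2 * expected_loss G (hellinger_loss G) \<pi> \<nu> h \<rho>)"
    using real_sqrt_le_mono by fastforce
qed

lemma self_play_pair_policies:
  assumes "self_play_pair R G f g \<pi> \<nu>"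
  shows "\<pi> \<in> max_policies G" "\<nu> \<in> min_policies G"
proof -
  obtain m where "obeys G f g \<pi> \<nu> m" using assms by (auto simp: self_play_pair_def)
  then show "\<pi> \<in> max_policies G" "\<nu> \<in> min_policies G"
    by (cases m; auto simp: is_arg_max_def is_arg_min_def)+
qed

section \<open>Summation over rounds and over the steps of an episode\<close>

text \<open>The factorisation is used in two ways. With the policies of round \<open>t\<close> it
  bounds the residual by \<open>w t \<bullet> x t\<close>; with those of an earlier round
  \<open>\<tau>\<close> it bounds \<open>w \<tau> \<bullet> x t\<close> by a misfit, hence by a loss
  at the data of round \<open>\<tau>\<close>. The inequality \<open>eluder\<close> links the
  two.\<close>

lemma sum_abs_bellman_residual_le:
  fixes W :: "nat \<Rightarrow> 'f \<Rightarrow> 'f \<Rightarrow> real ^ 'd::finite" and G :: "('s, 'a, 'b, 'f) game"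
  assumes G: "markov_game G" and U: "discriminator_class G U"
    and wit: "witness_factorization R G U W X \<kappa> B" and \<kappa>: "0 < \<kappa>" and C: "0 \<le> C"
    and eluder: "\<And>(w :: nat \<Rightarrow> real ^ 'd) x. (\<And>t. t \<in> {1..T} \<Longrightarrow> norm (w t) \<le> real (horizon G) * B \<and> norm (x t) \<le> 1)
      \<Longrightarrow> (\<Sum>t=1..T. \<bar>w t \<bullet> x t\<bar>) \<le> \<delta> * real T + C + C * sqrt (\<Sum>t=1..T. \<Sum>\<tau>=1..<t. (w \<tau> \<bullet> x t)\<^sup>2)"
    and play: "\<And>t. t \<in> {1..T} \<Longrightarrow>
      f t \<in> models G \<and> g t \<in> models G \<and> \<rho> t \<in> models G \<and> self_play_pair R G (f t) (g t) (\<pi> t) (\<nu> t)"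
    and h: "h \<in> {1..horizon G}"
  shows "\<kappa> * (\<Sum>t=1..T. \<bar>bellman_residual G (\<rho> t) (\<pi> t) (\<nu> t) h\<bar>) \<le> \<delta> * real T + C
    + C * sqrt (8 * (real (horizon G))\<^sup>2 *
        (\<Sum>t=1..T. \<Sum>\<tau>=1..<t. expected_loss G (hellinger_loss G) (\<pi> \<tau>) (\<nu> \<tau>) h (\<rho> t)))"
proof -
  define w where "w t = W h (f t) (g t)" for t
  define x where "x t = X h (\<rho> t)" for t
  let ?EL = "\<lambda>\<tau> t. expected_loss G (hellinger_loss G) (\<pi> \<tau>) (\<nu> \<tau>) h (\<rho> t)"
  have facts: "norm (w \<tau>) \<le> real (horizon G) * B \<and> norm (x t) \<le> 1"
      "\<kappa> * \<bar>bellman_residual G (\<rho> t) (\<pi> \<tau>) (\<nu> \<tau>) h\<bar> \<le> w \<tau> \<bullet> x t"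
      "w \<tau> \<bullet> x t \<le> model_misfit G U (\<pi> \<tau>) (\<nu> \<tau>) (\<rho> t) h"
    if "\<tau> \<in> {1..T}" "t \<in> {1..T}" for \<tau> t
    using wit h play[OF that(1)] play[OF that(2)] unfolding witness_factorization_def w_def x_def by blast+
  have "(w \<tau> \<bullet> x t)\<^sup>2 \<le> 8 * (real (horizon G))\<^sup>2 * ?EL \<tau> t" if t: "\<tau> \<in> {1..T}" "t \<in> {1..T}" for \<tau> t
  proof -
    \<comment> \<open>The misfit bounds the inner product from above only. Squaring also needs its
      sign, which the residual inequality supplies.\<close>
    have "0 \<le> \<kappa> * \<bar>bellman_residual G (\<rho> t) (\<pi> \<tau>) (\<nu> \<tau>) h\<bar>" using \<kappa> by simp
    then have "0 \<le> w \<tau> \<bullet> x t" using facts(2)[OF t] by linarith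
    moreover have "model_misfit G U (\<pi> \<tau>) (\<nu> \<tau>) (\<rho> t) h \<le> sqrt (8 * (real (horizon G))\<^sup>2 * ?EL \<tau> t)"
      by (rule model_misfit_le_sqrt_expected_loss[OF G _ _ U _ h])
        (use play[OF t(1)] play[OF t(2)] in \<open>auto intro: self_play_pair_policies\<close>)
    ultimately have "(w \<tau> \<bullet> x t)\<^sup>2 \<le> (sqrt (8 * (real (horizon G))\<^sup>2 * ?EL \<tau> t))\<^sup>2"
      using facts(3)[OF t] by (intro power_mono) linarith+
    then show ?thesis by (simp add: expected_loss_def)
  qed
  then have squares: "(\<Sum>t=1..T. \<Sum>\<tau>=1..<t. (w \<tau> \<bullet> x t)\<^sup>2) \<le>
      8 * (real (horizon G))\<^sup>2 * (\<Sum>t=1..T. \<Sum>\<tau>=1..<t. ?EL \<tau> t)"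
    unfolding sum_distrib_left by (intro sum_mono) auto
  have "\<kappa> * (\<Sum>t=1..T. \<bar>bellman_residual G (\<rho> t) (\<pi> t) (\<nu> t) h\<bar>) \<le> (\<Sum>t=1..T. \<bar>w t \<bullet> x t\<bar>)"
    unfolding sum_distrib_left using facts(2) by (intro sum_mono) (meson abs_ge_self order_trans)
  also have "\<dots> \<le> \<delta> * real T + C + C * sqrt (\<Sum>t=1..T. \<Sum>\<tau>=1..<t. (w \<tau> \<bullet> x t)\<^sup>2)"
    by (rule eluder) (use facts(1) in blast)
  also have "\<dots> \<le> \<delta> * real T + C
    + C * sqrt (8 * (real (horizon G))\<^sup>2 * (\<Sum>t=1..T. \<Sum>\<tau>=1..<t. ?EL \<tau> t))"
    using squares C by (intro add_left_mono mult_left_mono real_sqrt_le_mono)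
  finally show ?thesis .
qed

text \<open>After division by \<open>\<kappa>\<close>, \<open>slack\<close> turns the additive terms
  of each step into \<open>\<epsilon> * T\<close>. Bounding the loss of each step by the total loss
  costs a factor \<open>H\<close> outside the root; with the \<open>8 * H\<^sup>2\<close> inside,
  this is the origin of \<open>8 * H ^ 4 * C\<^sup>2 / \<kappa>\<^sup>2\<close>.\<close>

lemma GEC_constant_of_witness_factorization:
  fixes W :: "nat \<Rightarrow> 'f \<Rightarrow> 'f \<Rightarrow> real ^ 'd::finite" and G :: "('s, 'a, 'b, 'f) game"
  assumes G: "markov_game G" and U: "discriminator_class G U"
    and wit: "witness_factorization R G U W X \<kappa> B" and \<kappa>: "0 < \<kappa>" and C: "0 \<le> C"
    and eluder: "\<And>(w :: nat \<Rightarrow> real ^ 'd) x. (\<And>t. t \<in> {1..T} \<Longrightarrow> norm (w t) \<le> real (horizon G) * B \<and> norm (x t) \<le> 1)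
      \<Longrightarrow> (\<Sum>t=1..T. \<bar>w t \<bullet> x t\<bar>) \<le> \<delta> * real T + C + C * sqrt (\<Sum>t=1..T. \<Sum>\<tau>=1..<t. (w \<tau> \<bullet> x t)\<^sup>2)"
    and slack: "\<delta> * real T + C \<le> \<kappa> * \<epsilon> * real T"
    and D: "8 * real (horizon G) ^ 4 * C\<^sup>2 / \<kappa>\<^sup>2 \<le> D"
  shows "D \<in> GEC_constants R G (hellinger_loss G) T \<epsilon>"
proof -
  have "0 \<le> 8 * real (horizon G) ^ 4 * C\<^sup>2 / \<kappa>\<^sup>2" by simp
  then have D0: "0 \<le> D" using D by linarith
  have "\<bar>\<Sum>t=1..T. game_value G (\<rho> t) (\<pi> t) (\<nu> t) - game_value G (truth G) (\<pi> t) (\<nu> t)\<bar>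
      \<le> sqrt (D * (\<Sum>h=1..horizon G. \<Sum>t=1..T. \<Sum>\<tau>=1..<t.
            expected_loss G (hellinger_loss G) (\<pi> \<tau>) (\<nu> \<tau>) h (\<rho> t)))
        + 2 * real (horizon G) * sqrt (D * real (horizon G) * real T) + \<epsilon> * real (horizon G) * real T"
    if pairs: "\<forall>t\<in>{1..T}. f t \<in> models G \<and> g t \<in> models G \<and> self_play_pair R G (f t) (g t) (\<pi> t) (\<nu> t)"
      and \<rho>: "\<rho> \<in> {f, g}"
    for f g \<rho> :: "nat \<Rightarrow> 'f" and \<pi> \<nu>
  proof -
    have play: "f t \<in> models G \<and> g t \<in> models G \<and> \<rho> t \<in> models G
        \<and> self_play_pair R G (f t) (g t) (\<pi> t) (\<nu> t)" if "t \<in> {1..T}" for t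
      using pairs \<rho> that by auto
    have policies: "\<pi> t \<in> max_policies G" "\<nu> t \<in> min_policies G" if "t \<in> {1..T}" for t
      using self_play_pair_policies[of R G "f t" "g t"] play[OF that] by blast+
    let ?H = "real (horizon G)"
    define l where "l h = (\<Sum>t=1..T. \<Sum>\<tau>=1..<t. expected_loss G (hellinger_loss G) (\<pi> \<tau>) (\<nu> \<tau>) h (\<rho> t))" for h
    define L where "L = (\<Sum>h=1..horizon G. l h)"
    have l: "0 \<le> l h" for h by (auto simp: l_def expected_loss_def intro!: sum_nonneg)
    have L: "0 \<le> L" by (simp add: L_def l sum_nonneg)
    have lL: "l h \<le> L" if "h \<in> {1..horizon G}" for h
      unfolding L_def by (rule member_le_sum) (use that l in auto)
    have residuals: "(\<Sum>t=1..T. \<bar>bellman_residual G (\<rho> t) (\<pi> t) (\<nu> t) h\<bar>)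
        \<le> \<epsilon> * real T + C / \<kappa> * sqrt (8 * ?H\<^sup>2 * L)" if h: "h \<in> {1..horizon G}" for h
    proof -
      have "\<kappa> * (\<Sum>t=1..T. \<bar>bellman_residual G (\<rho> t) (\<pi> t) (\<nu> t) h\<bar>)
          \<le> \<delta> * real T + C + C * sqrt (8 * ?H\<^sup>2 * l h)"
        unfolding l_def by (rule sum_abs_bellman_residual_le[OF G U wit \<kappa> C eluder play h])
      also have "C * sqrt (8 * ?H\<^sup>2 * l h) \<le> C * sqrt (8 * ?H\<^sup>2 * L)"
        using lL[OF h] C by (intro mult_left_mono real_sqrt_le_mono) auto
      finally have "\<kappa> * (\<Sum>t=1..T. \<bar>bellman_residual G (\<rho> t) (\<pi> t) (\<nu> t) h\<bar>)
          \<le> \<kappa> * (\<epsilon> * real T + C / \<kappa> * sqrt (8 * ?H\<^sup>2 * L))"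
        using slack \<kappa> by (simp add: algebra_simps)
      then show ?thesis using \<kappa> by simp
    qed
    have "\<bar>\<Sum>t=1..T. game_value G (\<rho> t) (\<pi> t) (\<nu> t) - game_value G (truth G) (\<pi> t) (\<nu> t)\<bar>
        = \<bar>\<Sum>t=1..T. \<Sum>h=1..horizon G. bellman_residual G (\<rho> t) (\<pi> t) (\<nu> t) h\<bar>"
      by (intro arg_cong[where f = abs] sum.cong refl
          value_difference_eq_sum_bellman_residual[OF G])
        (use play policies in auto)
    also have "\<dots> \<le> (\<Sum>t=1..T. \<Sum>h=1..horizon G. \<bar>bellman_residual G (\<rho> t) (\<pi> t) (\<nu> t) h\<bar>)"
      by (intro order_trans[OF sum_abs] sum_mono sum_abs)
    also have "\<dots> = (\<Sum>h=1..horizon G. \<Sum>t=1..T. \<bar>bellman_residual G (\<rho> t) (\<pi> t) (\<nu> t) h\<bar>)"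
      by (rule sum.swap)
    also have "\<dots> \<le> (\<Sum>h=1..horizon G. \<epsilon> * real T + C / \<kappa> * sqrt (8 * ?H\<^sup>2 * L))"
      by (intro sum_mono residuals)
    also have "\<dots> = ?H * C / \<kappa> * sqrt (8 * ?H\<^sup>2 * L) + \<epsilon> * ?H * real T"
      by (simp add: algebra_simps)
    also have "?H * C / \<kappa> * sqrt (8 * ?H\<^sup>2 * L) = sqrt (8 * ?H ^ 4 * C\<^sup>2 / \<kappa>\<^sup>2 * L)"
    proof (rule real_sqrt_unique[symmetric])
      show "(?H * C / \<kappa> * sqrt (8 * ?H\<^sup>2 * L))\<^sup>2 = 8 * ?H ^ 4 * C\<^sup>2 / \<kappa>\<^sup>2 * L"
        using L by (simp add: power_mult_distrib power_divide power2_eq_square power4_eq_xxxx)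
    qed (use C \<kappa> L in simp)
    also have "\<dots> \<le> sqrt (D * L)" using D L by (intro real_sqrt_le_mono mult_right_mono)
    finally have "\<bar>\<Sum>t=1..T. game_value G (\<rho> t) (\<pi> t) (\<nu> t) - game_value G (truth G) (\<pi> t) (\<nu> t)\<bar>
        \<le> sqrt (D * L) + \<epsilon> * ?H * real T" by simp
    moreover have "0 \<le> 2 * ?H * sqrt (D * ?H * real T)" using D0 by simp
    ultimately show ?thesis unfolding L_def l_def by linarith
  qed
  with D0 show ?thesis unfolding GEC_constants_def by blast
qed

theorem propositionB7:
  fixes R :: "main_player set" and H :: nat and \<kappa> B \<epsilon> :: real
  assumes "\<kappa> > 0" and "\<epsilon> > 0"
  shows "\<forall>\<^sub>F T in sequentially.
    (low_witness_rank_games R H TYPE('d::finite) \<kappa> B :: ('s, 'a, 'b, 'f) game set)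
    \<subseteq> low_GEC_games R H T \<epsilon>
        (4 * real H ^ 3 * real CARD('d) / \<kappa>\<^sup>2 *
         ln (1 + real T * real H * B\<^sup>2 / (4 * real CARD('d) * \<epsilon> * \<kappa>\<^sup>2)))"
    (is "\<forall>\<^sub>F T in sequentially. ?low \<subseteq> low_GEC_games R H T \<epsilon> (?D T)")
proof -
  define \<delta> where "\<delta> = \<kappa> * \<epsilon> / 2"
  define eluder where "eluder C T \<longleftrightarrow> (\<forall>(w :: nat \<Rightarrow> real ^ 'd) x.
      (\<forall>t\<in>{1..T}. norm (w t) \<le> real H * B \<and> norm (x t) \<le> 1) \<longrightarrow>
      (\<Sum>t=1..T. \<bar>w t \<bullet> x t\<bar>) \<le>
        \<delta> * real T + C + C * sqrt (\<Sum>t=1..T. \<Sum>\<tau>=1..<t. (w \<tau> \<bullet> x t)\<^sup>2))" for C T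
  \<comment> \<open>All four conditions concern \<open>C\<close> and \<open>T\<close> alone, so a
    single threshold for \<open>T\<close> serves every game of the class.\<close>
  have conclude: "?low \<subseteq> low_GEC_games R H T \<epsilon> (?D T)"
    if "0 \<le> C" "eluder C T" "C \<le> \<delta> * real T" "8 * real H ^ 4 * C\<^sup>2 / \<kappa>\<^sup>2 \<le> ?D T" for C T
  proof
    fix G :: "('s, 'a, 'b, 'f) game" assume "G \<in> ?low"
    then obtain U and W :: "nat \<Rightarrow> 'f \<Rightarrow> 'f \<Rightarrow> real ^ 'd" and X
      where G: "markov_game G" "horizon G = H" and U: "discriminator_class G U"
        and wit: "witness_factorization R G U W X \<kappa> B"
      unfolding low_witness_rank_games_def by blast
    have "?D T \<in> GEC_constants R G (hellinger_loss G) T \<epsilon>"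
    proof (rule GEC_constant_of_witness_factorization[OF G(1) U wit assms(1) that(1)])
      fix w x :: "nat \<Rightarrow> real ^ 'd"
      assume "\<And>t. t \<in> {1..T} \<Longrightarrow> norm (w t) \<le> real (horizon G) * B \<and> norm (x t) \<le> 1"
      then show "(\<Sum>t=1..T. \<bar>w t \<bullet> x t\<bar>) \<le>
          \<delta> * real T + C + C * sqrt (\<Sum>t=1..T. \<Sum>\<tau>=1..<t. (w \<tau> \<bullet> x t)\<^sup>2)"
        using that(2) unfolding eluder_def G(2) by blast
    next
      show "\<delta> * real T + C \<le> \<kappa> * \<epsilon> * real T" using that(3) by (simp add: \<delta>_def)
      show "8 * real (horizon G) ^ 4 * C\<^sup>2 / \<kappa>\<^sup>2 \<le> ?D T" using that(4) by (simp only: G(2))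
    qed
    with G show "G \<in> low_GEC_games R H T \<epsilon> (?D T)" by (simp add: low_GEC_games_iff)
  qed
  have \<delta>: "0 < \<delta>" using assms by (simp add: \<delta>_def)
  \<comment> \<open>The logarithm grows only if \<open>H\<close> and \<open>B\<close> are nonzero.
    There is no game with horizon 0. For \<open>B = 0\<close> the claimed coefficient is 0, so
    \<open>C = 0\<close> has to do, and it does because every \<open>w t\<close> vanishes.\<close>
  consider "H = 0" | "H > 0" "B = 0" | "H > 0" "B \<noteq> 0" by auto
  then show ?thesis
  proof cases
    case 1
    then have "?low = {}" by (auto simp: low_witness_rank_games_def markov_game_def)
    then show ?thesis by simp
  next
    case 2
    then have "eluder 0 T" for T using \<delta> by (simp add: eluder_def)
    then show ?thesis using 2 \<delta> by (intro always_eventually allI conclude[of 0]) simp_all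
  next
    case 3
    \<comment> \<open>The net requires a nonnegative radius, while \<open>B\<close> may be negative;
      hence the absolute value.\<close>
    obtain C where C: "0 < C" "\<And>T (w :: nat \<Rightarrow> real ^ 'd) x.
        (\<And>t. t \<in> {1..T} \<Longrightarrow> norm (w t) \<le> real H * \<bar>B\<bar> \<and> norm (x t) \<le> 1) \<Longrightarrow>
        (\<Sum>t=1..T. \<bar>w t \<bullet> x t\<bar>) \<le>
          \<delta> * real T + C + C * sqrt (\<Sum>t=1..T. \<Sum>\<tau>=1..<t. (w \<tau> \<bullet> x t)\<^sup>2)"
      using sum_inner_le_earlier_squares[OF \<delta>, of "real H * \<bar>B\<bar>"] by auto
    have "real H * B \<le> real H * \<bar>B\<bar>" by (intro mult_left_mono) auto
    then have eluder: "eluder C T" for T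
      unfolding eluder_def using order_trans by (intro allI impI C(2)) blast
    \<comment> \<open>With these abbreviations the claimed coefficient is
      \<open>b * ln (1 + T * a)\<close>, where \<open>a\<close> and \<open>b\<close> are positive,
      and so it eventually exceeds any constant.\<close>
    define a where "a = real H * B\<^sup>2 / (4 * real CARD('d) * \<epsilon> * \<kappa>\<^sup>2)"
    define b where "b = 4 * real H ^ 3 * real CARD('d) / \<kappa>\<^sup>2"
    have ab: "0 < a" "0 < b" using 3 assms by (simp_all add: a_def b_def)
    have "filterlim (\<lambda>T. b * ln (1 + real T * a)) at_top sequentially"
      using ab by real_asymp
    moreover have "filterlim (\<lambda>T. \<delta> * real T) at_top sequentially" using \<delta> by real_asymp
    ultimately have "\<forall>\<^sub>F T in sequentially. 8 * real H ^ 4 * C\<^sup>2 / \<kappa>\<^sup>2 \<le> b * ln (1 + real T * a)"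
      "\<forall>\<^sub>F T in sequentially. C \<le> \<delta> * real T"
      unfolding filterlim_at_top by blast+
    then show ?thesis
    proof eventually_elim
      case (elim T)
      show ?case
        by (rule conclude[of C]) (use C(1) eluder elim in \<open>simp_all add: a_def b_def mult.assoc\<close>)
    qed
  qed
qed

end
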